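(* For every integer $r\ge 1$, let $f_d(r)$ denote the number of $d$-dimensional faces of the Kostka polytope $P_r$. Then $$f_1(r)=\binom{r}{6}+2\binom{r}{5}+6\binom{r}{4}+7\binom{r}{3}+3\binom{r}{2},$$ $$f_2(r)=\binom{r}{9}+3\binom{r}{8}+12\binom{r}{7}+23\binom{r}{6}+33\binom{r}{5}+31\binom{r}{4}+13\binom{r}{3}+\binom{r}{2},$$ $$f_3(r)=\binom{r}{12}+4\binom{r}{11}+19\binom{r}{10}+49\binom{r}{9}+105\binom{r}{8}+163\binom{r}{7}+177\binom{r}{6}+131\binom{r}{5}+53\binom{r}{4}+7\binom{r}{3}.$$
   Context: For a positive integer $r$, a partition with at most $r$ parts is written as a non-increasing $r$-tuple of nonnegative integers; $\mathrm{Par}_r(n)$ is the set of such tuples with entries summing to $n$. For $\lambda,\mu\in\mathrm{Par}_r(n)$, $\lambda$ dominates $\mu$ if $\sum_{i=1}^k\lambda_i\ge\sum_{i=1}^k\mu_i$ for all $k\le r$. The $r$-Kostka cone $\mathcal{K}_r\subseteq\mathbb{R}^{2r}$ is the convex hull of all points $(\lambda_1,\dots,\lambda_r,\mu_1,\dots,\mu_r)$ with $\lambda,\mu\in\mathrm{Par}_r(n)$ for some $n$ and $\lambda$ dominating $\mu$; it is a pointed $(2r-1)$-dimensional polyhedral cone. The Kostka polytope $P_r$ is the $(2r-2)$-dimensional polytope $\mathcal{K}_r\cap\{x:\sum_{i=1}^r(\lambda_i+\mu_i)=1\}$. *)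

theory Defs
  imports "HOL-Analysis.Analysis"
begin

text \<open>
  A partition with at most \<open>r\<close> parts is an \<open>r\<close>-tuple indexed by a finite linearly ordered
  type \<open>'r\<close> with \<open>CARD('r) = r\<close>; the order of \<open>'r\<close> plays the role of the order of
  \<open>1, \<dots>, r\<close>.  Such an index type exists for every \<open>r \<ge> 1\<close>.
\<close>

definition Par :: "nat \<Rightarrow> (nat ^ 'r::{finite,linorder}) set" where
  "Par n = {l. (\<forall>i j. i \<le> j \<longrightarrow> l $ j \<le> l $ i) \<and> (\<Sum>i\<in>UNIV. l $ i) = n}"

definition dominates :: "nat ^ 'r::{finite,linorder} \<Rightarrow> nat ^ 'r::{finite,linorder} \<Rightarrow> bool" where
  "dominates l m \<longleftrightarrow> (\<forall>k. (\<Sum>i\<in>{..k}. l $ i) \<ge> (\<Sum>i\<in>{..k}. m $ i))"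

definition real_vec :: "nat ^ 'r::finite \<Rightarrow> real ^ 'r::finite" where
  "real_vec v = (\<chi> i. real (v $ i))"

text \<open>The ambient space \<open>\<real>\<^sup>2\<^sup>r\<close> is rendered as the product \<open>\<real>\<^sup>r \<times> \<real>\<^sup>r\<close>.\<close>

type_synonym 'r kostka_space = "(real, 'r) vec \<times> (real, 'r) vec"

definition kostka_cone :: "'r::{finite,linorder} kostka_space set" where
  "kostka_cone =
     convex hull {(real_vec l, real_vec m) | l m. \<exists>n. l \<in> Par n \<and> m \<in> Par n \<and> dominates l m}"

definition kostka_polytope :: "'r::{finite,linorder} kostka_space set" where
  "kostka_polytope = kostka_cone \<inter> {(x, y). (\<Sum>i\<in>UNIV. x $ i + y $ i) = 1}"

text \<open>The empty face has \<open>aff_dim\<close> equal to \<open>-1\<close> and so is never counted.\<close>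

definition num_faces :: "nat \<Rightarrow> 'a::euclidean_space set \<Rightarrow> nat" where
  "num_faces d P = card {F. F face_of P \<and> aff_dim F = int d}"

end

theory Submission
  imports Defs
begin

text \<open>
  Put \<open>a\<^sub>i = x\<^sub>i - x\<^sub>i\<^sub>+\<^sub>1\<close>, \<open>b\<^sub>i = y\<^sub>i - y\<^sub>i\<^sub>+\<^sub>1\<close> (with \<open>x\<close>, \<open>y\<close> extended by \<open>0\<close>) and let \<open>s\<^sub>i\<close> be the difference of the
  \<open>i\<close>-th partial sums of \<open>x\<close> and \<open>y\<close>.  The cone is cut out by \<open>a, b, s \<ge> 0\<close> and \<open>s\<^sub>r = 0\<close>, and
  \<open>b\<^sub>i = a\<^sub>i + s\<^sub>i\<^sub>-\<^sub>1 - 2 s\<^sub>i + s\<^sub>i\<^sub>+\<^sub>1\<close>.  A face is determined by the inequalities that are tight on it,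
  recorded by one of six letters at each position.  A word of letters is realised iff it ends in a
  zero of \<open>s\<close> and \<open>s\<close> can be positive between consecutive zeros, that is, iff every run of nonzero
  positions contains one at which \<open>s\<close> may be strictly concave.  Prescribing all \<open>a\<^sub>i\<close>, and \<open>s\<^sub>i\<close> at the
  zeros and \<open>b\<^sub>i\<close> elsewhere, is a bijective linear system, so the dimension of a face is the
  number of free coordinates minus one.  A three-state automaton counts the words by weight.
\<close>

subsection \<open>Counting words\<close>

text \<open>
  \<open>Zero_*\<close>: \<open>s\<^sub>i = 0\<close>, with \<open>a\<^sub>i = 0\<close> or \<open>a\<^sub>i > 0\<close>.  The other letters have \<open>s\<^sub>i > 0\<close> and record which of
  \<open>a\<^sub>i\<close>, \<open>b\<^sub>i\<close> vanish: both (\<open>s\<close> is flat at \<open>i\<close>), only \<open>a\<^sub>i\<close> (strictly convex), only \<open>b\<^sub>i\<close> (strictly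
  concave), or neither.
\<close>

datatype letter = Zero_tight | Zero_slack | Flat | Convex | Concave | Slack

text \<open>
  The automaton rejects a maximal run of non-\<open>Zero\<close> letters that lacks a \<open>Concave\<close> or \<open>Slack\<close> letter;
  \<open>Rising\<close> means that the current run still lacks one.
\<close>

datatype state = Outside | Rising | Inside

fun zero_letter :: "letter \<Rightarrow> bool" where
  "zero_letter Zero_tight = True"
| "zero_letter Zero_slack = True"
| "zero_letter _ = False"

fun bump_letter :: "letter \<Rightarrow> bool" where
  "bump_letter Concave = True"
| "bump_letter Slack = True"
| "bump_letter _ = False"

text \<open>Counts the coordinates left free at a position: \<open>a\<close> where it is positive,
  and \<open>b\<close> where \<open>s\<close> and \<open>b\<close> are both positive. At a zero of
  \<open>s\<close> the second coordinate is \<open>s\<close> itself, fixed at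
  \<open>0\<close>.\<close>

fun letter_weight :: "letter \<Rightarrow> nat" where
  "letter_weight Zero_tight = 0"
| "letter_weight Zero_slack = 1"
| "letter_weight Flat = 0"
| "letter_weight Convex = 1"
| "letter_weight Concave = 1"
| "letter_weight Slack = 2"

definition word_weight :: "letter list \<Rightarrow> nat" where
  "word_weight w = (\<Sum>c\<leftarrow>w. letter_weight c)"

definition step :: "state \<Rightarrow> letter \<Rightarrow> state" where
  "step q c = (if zero_letter c then Outside else if bump_letter c then Inside
     else if q = Outside then Rising else q)"

fun accepts :: "state \<Rightarrow> letter list \<Rightarrow> bool" where
  "accepts q [] \<longleftrightarrow> q = Outside"
| "accepts q (c # w) \<longleftrightarrow> \<not> (q = Rising \<and> zero_letter c) \<and> accepts (step q c) w"

definition words :: "state \<Rightarrow> nat \<Rightarrow> nat \<Rightarrow> letter list set" where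
  "words q n k = {w. length w = n \<and> accepts q w \<and> word_weight w = k}"

lemma UNIV_letter: "UNIV = {Zero_tight, Zero_slack, Flat, Convex, Concave, Slack}"
  using letter.exhaust by blast

lemma finite_words: "finite (words q n k)"
proof -
  have "finite {w :: letter list. set w \<subseteq> UNIV \<and> length w = n}"
    by (rule finite_lists_length_eq) (simp add: UNIV_letter)
  then show ?thesis
    by (rule rev_finite_subset) (auto simp: words_def)
qed

lemma card_words_0: "card (words q 0 k) = (if q = Outside \<and> k = 0 then 1 else 0)"
proof -
  have "words q 0 k = (if q = Outside \<and> k = 0 then {[]} else {})"
    by (auto simp: words_def word_weight_def)
  then show ?thesis by simp
qed

text \<open>Splits off the first letter. The guard \<open>k < letter_weight c\<close> is there
  because subtraction on \<open>nat\<close> truncates.\<close>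

lemma card_words_Suc:
  "card (words q (Suc n) k) = (\<Sum>c\<in>UNIV. if (q = Rising \<and> zero_letter c) \<or> k < letter_weight c then 0
     else card (words (step q c) n (k - letter_weight c)))"
proof -
  define W where "W c = (if (q = Rising \<and> zero_letter c) \<or> k < letter_weight c then {}
     else words (step q c) n (k - letter_weight c))" for c
  have "words q (Suc n) k = (\<Union>c\<in>UNIV. (#) c ` W c)"
  proof (intro equalityI subsetI)
    fix w assume w: "w \<in> words q (Suc n) k"
    then obtain c v where "w = c # v"
      by (cases w) (auto simp: words_def)
    with w show "w \<in> (\<Union>c\<in>UNIV. (#) c ` W c)"
      by (auto simp: words_def W_def word_weight_def)
  qed (auto simp: words_def W_def word_weight_def split: if_splits)
  also have "card \<dots> = (\<Sum>c\<in>UNIV. card ((#) c ` W c))"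
    by (rule card_UN_disjoint) (auto simp: W_def finite_words UNIV_letter)
  also have "\<dots> = (\<Sum>c\<in>UNIV. card (W c))"
    by (simp add: card_image)
  finally show ?thesis
    by (simp add: W_def if_distrib cong: if_cong)
qed

lemma card_words_Suc_state:
  "card (words Outside (Suc n) k) = card (words Outside n k) + card (words Rising n k)
     + (if k < 1 then 0 else card (words Outside n (k - 1)) + card (words Rising n (k - 1)) + card (words Inside n (k - 1)))
     + (if k < 2 then 0 else card (words Inside n (k - 2)))"
  "card (words Rising (Suc n) k) = card (words Rising n k)
     + (if k < 1 then 0 else card (words Rising n (k - 1)) + card (words Inside n (k - 1)))
     + (if k < 2 then 0 else card (words Inside n (k - 2)))"
  "card (words Inside (Suc n) k) = card (words Outside n k) + card (words Inside n k)
     + (if k < 1 then 0 else card (words Outside n (k - 1)) + 2 * card (words Inside n (k - 1)))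
     + (if k < 2 then 0 else card (words Inside n (k - 2)))"
  by (simp_all add: card_words_Suc UNIV_letter step_def)

lemma choose_Suc_numeral:
  "Suc n choose numeral k = (n choose pred_numeral k) + (n choose numeral k)"
  by (simp add: numeral_eq_Suc)

text \<open>The recursion couples the states at equal weight, so the closed forms of one weight are
  proved by simultaneous induction. In the binomial basis the step is Pascal's rule combined with
  the closed forms for lower weights.\<close>

lemma card_words_weight_0:
  "card (words Rising n 0) = 0"
  "card (words Outside n 0) = 1"
  "card (words Inside n 0) = n"
  by (induction n) (simp_all add: card_words_0 card_words_Suc_state choose_Suc_numeral )

lemma card_words_weight_1:
  "card (words Rising n (Suc 0)) = (n choose 2)"
  "card (words Outside n (Suc 0)) = (n choose 3) + (n choose 2) + n"
  "card (words Inside n (Suc 0)) = (n choose 4) + (n choose 3) + 3 * (n choose 2) + n"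
  by (induction n) (simp_all add: card_words_0 card_words_Suc_state choose_Suc_numeral card_words_weight_0)

lemma card_words_weight_2:
  "card (words Rising n 2) = (n choose 5) + (n choose 4) + 4 * (n choose 3) + 2 * (n choose 2)"
  "card (words Outside n 2) = (n choose 6) + 2 * (n choose 5) + 6 * (n choose 4) + 7 * (n choose 3) + 3 * (n choose 2)"
  "card (words Inside n 2) = (n choose 7) + 2 * (n choose 6) + 8 * (n choose 5) + 10 * (n choose 4) + 10 * (n choose 3) + 4 * (n choose 2)"
  by (induction n) (simp_all add: card_words_0 card_words_Suc_state choose_Suc_numeral card_words_weight_0 card_words_weight_1)

lemma card_words_weight_3:
  "card (words Rising n 3) = (n choose 8) + 2 * (n choose 7) + 9 * (n choose 6) + 12 * (n choose 5) + 15 * (n choose 4) + 9 * (n choose 3) + (n choose 2)"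
  "card (words Outside n 3) = (n choose 9) + 3 * (n choose 8) + 12 * (n choose 7) + 23 * (n choose 6) + 33 * (n choose 5) + 31 * (n choose 4) + 13 * (n choose 3) + (n choose 2)"
  "card (words Inside n 3) = (n choose 10) + 3 * (n choose 9) + 14 * (n choose 8) + 28 * (n choose 7) + 51 * (n choose 6) + 58 * (n choose 5) + 41 * (n choose 4) + 15 * (n choose 3) + (n choose 2)"
  by (induction n) (simp_all add: card_words_0 card_words_Suc_state choose_Suc_numeral card_words_weight_1 card_words_weight_2)

text \<open>\<open>Inside\<close> can be omitted: the recursions of \<open>Rising\<close> and
  \<open>Outside\<close> call on it only at the weights \<open>3\<close> and
  \<open>2\<close>.\<close>

lemma card_words_weight_4:
  "card (words Rising n 4) = (n choose 11) + 3 * (n choose 10) + 15 * (n choose 9) + 31 * (n choose 8) + 62 * (n choose 7) + 78 * (n choose 6) + 66 * (n choose 5) + 34 * (n choose 4) + 6 * (n choose 3)"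
  "card (words Outside n 4) = (n choose 12) + 4 * (n choose 11) + 19 * (n choose 10) + 49 * (n choose 9) + 105 * (n choose 8) + 163 * (n choose 7) + 177 * (n choose 6) + 131 * (n choose 5) + 53 * (n choose 4) + 7 * (n choose 3)"
  by (induction n) (simp_all add: card_words_0 card_words_Suc_state choose_Suc_numeral card_words_weight_2 card_words_weight_3)

subsection \<open>Coordinates\<close>

text \<open>The index type has an order but no successor operation. Its increasing enumeration moves
  everything to positions in \<open>nat\<close>, where differences and partial sums can be
  formed.\<close>

definition idx :: "nat \<Rightarrow> 'r::{finite,linorder}" where
  "idx n = sorted_list_of_set UNIV ! n"

definition pos :: "'r::{finite,linorder} \<Rightarrow> nat" where
  "pos = inv_into {..<CARD('r)} idx"

lemma bij_betw_idx: "bij_betw idx {..<CARD('r)} (UNIV :: 'r::{finite,linorder} set)"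
proof -
  have "bij_betw (\<lambda>n. sorted_list_of_set (UNIV :: 'r set) ! n) {..<CARD('r)} UNIV"
    by (rule bij_betw_nth) auto
  then show ?thesis
    by (simp add: idx_def[abs_def])
qed

lemma pos_less [simp]: "pos (i :: 'r::{finite,linorder}) < CARD('r)"
  using bij_betwE[OF bij_betw_inv_into[OF bij_betw_idx]] by (auto simp: pos_def)

lemma idx_pos [simp]: "idx (pos i) = i"
  using bij_betw_inv_into_right[OF bij_betw_idx] by (simp add: pos_def)

lemma pos_idx [simp]: "n < CARD('r) \<Longrightarrow> pos (idx n :: 'r::{finite,linorder}) = n"
  using bij_betw_inv_into_left[OF bij_betw_idx, of n] by (simp add: pos_def)

lemma idx_le_iff:
  assumes "m < CARD('r)" "n < CARD('r)"
  shows "(idx m :: 'r::{finite,linorder}) \<le> idx n \<longleftrightarrow> m \<le> n"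
proof -
  have *: "(idx a :: 'r) < idx b" if "a < b" "b < CARD('r)" for a b
    using that sorted_wrt_nth_less[OF strict_sorted_list_of_set, of a b "UNIV :: 'r set"]
    by (simp add: idx_def)
  show ?thesis
    using *[of m n] *[of n m] assms by (cases m n rule: linorder_cases) (auto simp: not_le)
qed

lemma sum_UNIV_idx: "(\<Sum>i\<in>UNIV. f i) = (\<Sum>n<CARD('r). f (idx n :: 'r::{finite,linorder}))"
  by (rule sum.reindex_bij_betw[OF bij_betw_idx, symmetric])

lemma sum_atMost_idx:
  assumes "k < CARD('r)"
  shows "(\<Sum>i\<in>{..idx k}. f i) = (\<Sum>n<Suc k. f (idx n :: 'r::{finite,linorder}))"
proof (rule sum.reindex_bij_witness[of _ idx pos])
  show "pos a \<in> {..<Suc k}" if "a \<in> {..idx k}" for a :: 'r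
    using that idx_le_iff[of "pos a" k, where ?'r = 'r] assms by simp
  show "idx b \<in> {..(idx k :: 'r)}" if "b \<in> {..<Suc k}" for b
    using that idx_le_iff[of b k, where ?'r = 'r] assms by simp
qed (use assms in auto)

text \<open>With the extension by \<open>0\<close> the last difference is the last entry, so
  nonnegativity of the entries is contained in the inequalities on differences.\<close>

definition xc :: "'r::{finite,linorder} kostka_space \<Rightarrow> nat \<Rightarrow> real" where
  "xc p n = (if n < CARD('r) then fst p $ idx n else 0)"

definition yc :: "'r::{finite,linorder} kostka_space \<Rightarrow> nat \<Rightarrow> real" where
  "yc p n = (if n < CARD('r) then snd p $ idx n else 0)"

text \<open>
  \<open>da\<close>, \<open>db\<close>, \<open>ps\<close> are \<open>a\<close>, \<open>b\<close>, \<open>s\<close> with 0-based positions: position \<open>n\<close> carries \<open>da p n\<close>, \<open>db p n\<close> and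
  \<open>ps p (Suc n)\<close>.
\<close>

definition da :: "'r::{finite,linorder} kostka_space \<Rightarrow> nat \<Rightarrow> real" where
  "da p n = xc p n - xc p (Suc n)"

definition db :: "'r::{finite,linorder} kostka_space \<Rightarrow> nat \<Rightarrow> real" where
  "db p n = yc p n - yc p (Suc n)"

definition ps :: "'r::{finite,linorder} kostka_space \<Rightarrow> nat \<Rightarrow> real" where
  "ps p n = (\<Sum>m<n. xc p m - yc p m)"

text \<open>Collects the three families of inequalities into one, so that supports and sets of tight
  inequalities can be treated uniformly.\<close>

fun con :: "'r::{finite,linorder} kostka_space \<Rightarrow> nat + nat + nat \<Rightarrow> real" where
  "con p (Inl n) = da p n"
| "con p (Inr (Inl n)) = db p n"
| "con p (Inr (Inr n)) = ps p n"

definition ineq_cone :: "'r::{finite,linorder} kostka_space set" where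
  "ineq_cone = {p. (\<forall>j. 0 \<le> con p j) \<and> ps p CARD('r) = 0}"

lemma ineq_coneD:
  assumes "(p :: 'r::{finite,linorder} kostka_space) \<in> ineq_cone"
  shows "0 \<le> da p n" "0 \<le> db p n" "0 \<le> ps p n" "ps p CARD('r) = 0" "0 \<le> con p j"
  using assms[unfolded ineq_cone_def mem_Collect_eq, THEN conjunct1, rule_format, of "Inl n"]
    assms[unfolded ineq_cone_def mem_Collect_eq, THEN conjunct1, rule_format, of "Inr (Inl n)"]
    assms[unfolded ineq_cone_def mem_Collect_eq, THEN conjunct1, rule_format, of "Inr (Inr n)"]
    assms
  by (simp_all add: ineq_cone_def)

lemma ineq_coneI:
  assumes "\<And>n. 0 \<le> da p n" "\<And>n. 0 \<le> db p n" "\<And>n. 0 \<le> ps p n"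
    "ps (p :: 'r::{finite,linorder} kostka_space) CARD('r) = 0"
  shows "p \<in> ineq_cone"
  using assms by (auto simp: ineq_cone_def split_sum_all)

lemma xc_linear: "xc (p + q) n = xc p n + xc q n" "xc (c *\<^sub>R p) n = c * xc p n"
    "xc (p - q) n = xc p n - xc q n"
  and yc_linear: "yc (p + q) n = yc p n + yc q n" "yc (c *\<^sub>R p) n = c * yc p n"
    "yc (p - q) n = yc p n - yc q n"
  by (auto simp: xc_def yc_def)

lemma da_linear: "da (p + q) n = da p n + da q n" "da (c *\<^sub>R p) n = c * da p n"
    "da (p - q) n = da p n - da q n"
  and db_linear: "db (p + q) n = db p n + db q n" "db (c *\<^sub>R p) n = c * db p n"
    "db (p - q) n = db p n - db q n"
  and ps_linear: "ps (p + q) n = ps p n + ps q n" "ps (c *\<^sub>R p) n = c * ps p n"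
    "ps (p - q) n = ps p n - ps q n"
  by (simp_all add: da_def db_def ps_def xc_linear yc_linear algebra_simps sum.distrib
      sum_subtractf sum_distrib_left)

lemma xc_0 [simp]: "xc 0 n = 0" and yc_0 [simp]: "yc 0 n = 0"
  by (simp_all add: xc_def yc_def)

lemma da_0 [simp]: "da 0 n = 0" and db_0 [simp]: "db 0 n = 0" and ps_of_0 [simp]: "ps 0 n = 0"
  by (simp_all add: da_def db_def ps_def)

lemma con_linear: "con (p + q) j = con p j + con q j" "con (c *\<^sub>R p) j = c * con p j"
    "con (p - q) j = con p j - con q j"
  by (cases "(p, j)" rule: con.cases; simp add: da_linear db_linear ps_linear)
    (cases "(p, j)" rule: con.cases; simp add: da_linear db_linear ps_linear)+

lemma ps_0 [simp]: "ps p 0 = 0"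
  by (simp add: ps_def)

lemma ps_Suc: "ps p (Suc n) = ps p n + xc p n - yc p n"
  by (simp add: ps_def)

text \<open>Valid for all \<open>n\<close>, since coordinates beyond \<open>CARD('r)\<close> are \<open>0\<close>.\<close>

lemma db_eq: "db p n = da p n + ps p n + ps p (Suc (Suc n)) - 2 * ps p (Suc n)"
  by (simp add: da_def db_def ps_Suc)

lemma outside_range:
  assumes "CARD('r) \<le> n"
  shows "xc p n = 0" "yc p n = 0" "da p n = 0" "db p n = 0"
    "ps (p :: 'r::{finite,linorder} kostka_space) n = ps p CARD('r)"
proof -
  show "ps p n = ps p CARD('r)"
    using assms by (induction rule: dec_induct) (auto simp: ps_Suc xc_def yc_def)
qed (use assms in \<open>auto simp: xc_def yc_def da_def db_def\<close>)

lemma xc_eq_sum_da: "n \<le> CARD('r) \<Longrightarrow> xc p n = (\<Sum>m=n..<CARD('r). da (p :: 'r::{finite,linorder} kostka_space) m)"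
  by (induction rule: inc_induct) (simp_all add: sum.atLeast_Suc_lessThan da_def outside_range)

lemma yc_eq_sum_db: "n \<le> CARD('r) \<Longrightarrow> yc p n = (\<Sum>m=n..<CARD('r). db (p :: 'r::{finite,linorder} kostka_space) m)"
  by (induction rule: inc_induct) (simp_all add: sum.atLeast_Suc_lessThan db_def outside_range)

lemma xc_nonneg: "p \<in> ineq_cone \<Longrightarrow> 0 \<le> xc (p :: 'r::{finite,linorder} kostka_space) n"
  using xc_eq_sum_da[of n p] outside_range(1)[of n p]
  by (cases "n \<le> CARD('r)") (auto intro!: sum_nonneg simp: ineq_coneD)

lemma yc_nonneg: "p \<in> ineq_cone \<Longrightarrow> 0 \<le> yc (p :: 'r::{finite,linorder} kostka_space) n"
  using yc_eq_sum_db[of n p] outside_range(2)[of n p]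
  by (cases "n \<le> CARD('r)") (auto intro!: sum_nonneg simp: ineq_coneD)

lemma kostka_space_eqI:
  assumes "\<And>n. xc p n = xc q n" "\<And>n. yc p n = yc q n"
  shows "p = (q :: 'r::{finite,linorder} kostka_space)"
proof (rule prod_eqI; rule vec_eq_iff[THEN iffD2]; rule allI)
  fix i :: 'r
  show "fst p $ i = fst q $ i" "snd p $ i = snd q $ i"
    using assms(1)[of "pos i"] assms(2)[of "pos i"] by (simp_all add: xc_def yc_def)
qed

lemma eq_0_if_da_ps_0:
  assumes "\<And>n. n < CARD('r) \<Longrightarrow> da p n = 0" "\<And>n. n \<le> CARD('r) \<Longrightarrow> ps p n = 0"
  shows "p = (0 :: 'r::{finite,linorder} kostka_space)"
proof (rule kostka_space_eqI)
  show x0: "xc p n = xc (0 :: 'r kostka_space) n" for n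
    using xc_eq_sum_da[of n p] outside_range(1)[of n p] assms(1)
    by (cases "n \<le> CARD('r)") (auto simp: xc_def)
  show "yc p n = yc 0 n" for n
    using ps_Suc[of p n] assms(2)[of n] assms(2)[of "Suc n"] outside_range(2)[of n p] x0[of n]
    by (cases "n < CARD('r)") (auto simp: xc_def yc_def)
qed

subsection \<open>Lattice points generate the cone\<close>

definition lattice_points :: "'r::{finite,linorder} kostka_space set" where
  "lattice_points = {(real_vec l, real_vec m) | l m. \<exists>n. l \<in> Par n \<and> m \<in> Par n \<and> dominates l m}"

lemma nonincreasing_iff:
  fixes f :: "nat \<Rightarrow> real"
  assumes "\<And>n. CARD('r) \<le> n \<Longrightarrow> f n = 0" "\<And>n. 0 \<le> f n"
  shows "(\<forall>i j. i \<le> j \<longrightarrow> f (pos j) \<le> f (pos (i::'r::{finite,linorder}))) \<longleftrightarrow> (\<forall>n. 0 \<le> f n - f (Suc n))"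
proof
  assume mono: "\<forall>i j. i \<le> j \<longrightarrow> f (pos j) \<le> f (pos (i::'r))"
  show "\<forall>n. 0 \<le> f n - f (Suc n)"
  proof
    fix n
    show "0 \<le> f n - f (Suc n)"
    proof (cases "Suc n < CARD('r)")
      case True
      then show ?thesis
        using mono[rule_format, of "idx n" "idx (Suc n)"] idx_le_iff[of n "Suc n", where ?'r = 'r] by simp
    qed (use assms in simp)
  qed
next
  assume "\<forall>n. 0 \<le> f n - f (Suc n)"
  then have "f n \<le> f m" if "m \<le> n" for m n
    using that lift_Suc_antimono_le[of f m n] by simp
  then show "\<forall>i j. i \<le> j \<longrightarrow> f (pos j) \<le> f (pos (i::'r))"
    using idx_le_iff[where ?'r = 'r] pos_less idx_pos by metis
qed

lemma real_vec_in_ineq_cone_iff: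
  fixes l m :: "nat ^ 'r::{finite,linorder}"
  shows "(real_vec l, real_vec m) \<in> ineq_cone \<longleftrightarrow> (\<exists>n. l \<in> Par n \<and> m \<in> Par n \<and> dominates l m)"
proof -
  define p where "p = (real_vec l, real_vec m)"
  have x: "xc p (pos i) = real (l $ i)" and y: "yc p (pos i) = real (m $ i)" for i
    by (simp_all add: xc_def yc_def p_def real_vec_def)
  have nn: "0 \<le> xc p n" "0 \<le> yc p n" for n
    by (simp_all add: xc_def yc_def p_def real_vec_def)
  have da: "(\<forall>i j. i \<le> j \<longrightarrow> l $ j \<le> l $ i) \<longleftrightarrow> (\<forall>n. 0 \<le> da p n)"
    using nonincreasing_iff[of "xc p", where ?'r = 'r] nn outside_range(1)[of _ p]
    by (simp add: x da_def)
  have db: "(\<forall>i j. i \<le> j \<longrightarrow> m $ j \<le> m $ i) \<longleftrightarrow> (\<forall>n. 0 \<le> db p n)"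
    using nonincreasing_iff[of "yc p", where ?'r = 'r] nn outside_range(2)[of _ p]
    by (simp add: y db_def)
  have tot: "ps p CARD('r) = real (\<Sum>i\<in>UNIV. l $ i) - real (\<Sum>i\<in>UNIV. m $ i)"
    by (simp add: ps_def xc_def yc_def p_def real_vec_def sum_UNIV_idx sum_subtractf)
  have part: "ps p (Suc k) = real (\<Sum>i\<in>{..idx k}. l $ i) - real (\<Sum>i\<in>{..idx k}. m $ i)"
    if "k < CARD('r)" for k
    unfolding sum_atMost_idx[OF that] using that
    by (simp add: ps_def xc_def yc_def p_def real_vec_def sum_subtractf)
  have dom: "dominates l m \<longleftrightarrow> (\<forall>k<CARD('r). 0 \<le> ps p (Suc k))"
  proof
    assume "dominates l m"
    then show "\<forall>k<CARD('r). 0 \<le> ps p (Suc k)"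
      unfolding dominates_def using part of_nat_mono by (metis diff_ge_0_iff_ge)
  next
    assume *: "\<forall>k<CARD('r). 0 \<le> ps p (Suc k)"
    show "dominates l m"
      unfolding dominates_def
    proof
      fix i :: 'r
      show "sum (($) m) {..i} \<le> sum (($) l) {..i}"
        using part[of "pos i"] *[rule_format, of "pos i"] by (simp flip: of_nat_sum)
    qed
  qed
  \<comment> \<open>Beyond \<open>CARD('r)\<close> the partial sums stay constant, so once the
    totals agree the dominance conditions cover all positions.\<close>
  have ps: "(\<forall>k<CARD('r). 0 \<le> ps p (Suc k)) \<longleftrightarrow> (\<forall>n. 0 \<le> ps p n)" if "ps p CARD('r) = 0"
  proof
    assume *: "\<forall>k<CARD('r). 0 \<le> ps p (Suc k)"
    show "\<forall>n. 0 \<le> ps p n"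
    proof
      fix n
      show "0 \<le> ps p n"
        using * outside_range(5)[of n p] that by (cases n; cases "n \<le> CARD('r)") auto
    qed
  qed auto
  have "p \<in> ineq_cone \<longleftrightarrow> (\<forall>n. 0 \<le> da p n) \<and> (\<forall>n. 0 \<le> db p n) \<and> (\<forall>n. 0 \<le> ps p n) \<and> ps p CARD('r) = 0"
    by (auto simp: ineq_cone_def split_sum_all)
  also have "\<dots> \<longleftrightarrow> (\<exists>n. l \<in> Par n \<and> m \<in> Par n \<and> dominates l m)"
    unfolding Par_def mem_Collect_eq da db dom using ps tot
    by (metis diff_eq_diff_eq diff_self of_nat_eq_iff)
  finally show ?thesis
    by (simp add: p_def)
qed

lemma lattice_points_eq: "lattice_points = {(real_vec l, real_vec m) | l m. (real_vec l, real_vec m) \<in> ineq_cone}"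
  by (simp add: lattice_points_def real_vec_in_ineq_cone_iff)

section \<open>Closure of the cone and of the hull under sums and nonnegative multiples\<close>

lemma ineq_cone_add: "p \<in> ineq_cone \<Longrightarrow> q \<in> ineq_cone \<Longrightarrow> p + q \<in> ineq_cone"
  by (auto simp: ineq_cone_def con_linear ps_linear)

lemma ineq_cone_scale: "p \<in> ineq_cone \<Longrightarrow> 0 \<le> c \<Longrightarrow> c *\<^sub>R p \<in> ineq_cone"
  by (auto simp: ineq_cone_def con_linear ps_linear)

lemma convex_ineq_cone: "convex ineq_cone"
  by (auto intro!: convexI ineq_cone_add ineq_cone_scale)

text \<open>Integer multiples of lattice points are lattice points. Hence \<open>p\<close> can be
  blown up by an integer \<open>N > c\<close> and then shrunk towards \<open>0\<close>, itself a
  lattice point.\<close>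

lemma hull_lattice_points_scale:
  assumes "p \<in> convex hull lattice_points" "0 \<le> c"
  shows "c *\<^sub>R p \<in> convex hull (lattice_points :: 'r::{finite,linorder} kostka_space set)"
proof -
  obtain N :: nat where N: "c < real N"
    using reals_Archimedean2 by blast
  have scale: "real k *\<^sub>R q \<in> lattice_points" if q: "q \<in> lattice_points" for k and q :: "'r kostka_space"
  proof -
    obtain l m where q: "q = (real_vec l, real_vec m)" "q \<in> ineq_cone"
      using q by (auto simp: lattice_points_eq)
    have "real k *\<^sub>R q = (real_vec (\<chi> i. k * l $ i), real_vec (\<chi> i. k * m $ i))"
      by (simp add: q real_vec_def vec_eq_iff)
    moreover have "real k *\<^sub>R q \<in> ineq_cone"
      by (rule ineq_cone_scale[OF q(2)]) simp
    ultimately show ?thesis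
      unfolding lattice_points_eq by (metis (mono_tags, lifting) mem_Collect_eq)
  qed
  have "real N *\<^sub>R p \<in> (*\<^sub>R) (real N) ` (convex hull lattice_points)"
    using assms by blast
  also have "\<dots> = convex hull ((*\<^sub>R) (real N) ` lattice_points)"
    by (rule convex_hull_scaling[symmetric])
  also have "\<dots> \<subseteq> convex hull lattice_points"
    by (rule hull_mono) (use scale in blast)
  finally have *: "real N *\<^sub>R p \<in> convex hull lattice_points" .
  have "(real 0 *\<^sub>R 0 :: 'r kostka_space) \<in> convex hull lattice_points"
  proof (rule hull_inc)
    have "(0 :: 'r kostka_space) = (real_vec 0, real_vec 0)"
      by (simp add: real_vec_def vec_eq_iff zero_prod_def)
    moreover have "(0 :: 'r kostka_space) \<in> ineq_cone"
      by (simp add: ineq_coneI)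
    ultimately show "(real 0 *\<^sub>R 0 :: 'r kostka_space) \<in> lattice_points"
      unfolding lattice_points_eq by (metis (mono_tags, lifting) mem_Collect_eq scaleR_zero_right)
  qed
  then have "(c / real N) *\<^sub>R (real N *\<^sub>R p) + (1 - c / real N) *\<^sub>R 0 \<in> convex hull lattice_points"
    using N assms by (intro convexD[OF convex_convex_hull *]) (auto simp: field_simps)
  then show ?thesis
    using N assms(2) by simp
qed

lemma hull_lattice_points_add:
  assumes "p \<in> convex hull lattice_points" "q \<in> convex hull lattice_points"
  shows "p + q \<in> convex hull lattice_points"
proof -
  have "(1/2) *\<^sub>R (2 *\<^sub>R p) + (1/2) *\<^sub>R (2 *\<^sub>R q) \<in> convex hull lattice_points"
    by (rule convexD[OF convex_convex_hull]) (auto intro!: hull_lattice_points_scale assms)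
  then show ?thesis by simp
qed

text \<open>
  The ray for which \<open>s\<close> is the tent function supported on \<open>i<..<j\<close> with peak at \<open>k\<close>;
  for \<open>i = k\<close> and \<open>j = k + 1\<close> it degenerates to \<open>x = y = (1\<^sup>k)\<close>.
\<close>

definition ray_x :: "nat \<Rightarrow> nat \<Rightarrow> nat \<Rightarrow> nat ^ 'r::{finite,linorder}" where
  "ray_x i k j = (\<chi> c. if pos c < k then j - i else 0)"

definition ray_y :: "nat \<Rightarrow> nat \<Rightarrow> nat \<Rightarrow> nat ^ 'r::{finite,linorder}" where
  "ray_y i k j = (\<chi> c. if pos c < i then j - i else if pos c < j then k - i else 0)"

text \<open>Only \<open>a\<close> at the peak and \<open>b\<close> at the two feet can be nonzero.
  In the degenerate case \<open>i = k\<close> the foot \<open>j\<close> may lie beyond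
  \<open>CARD('r)\<close>, since \<open>ray_y\<close> is then \<open>0\<close> from position
  \<open>i\<close> on.\<close>

lemma ray_coordinates:
  fixes i j k :: nat
  defines "v \<equiv> (real_vec (ray_x i k j), real_vec (ray_y i k j)) :: 'r::{finite,linorder} kostka_space"
  assumes "i \<le> k" "k < j" "k \<le> CARD('r)" "j \<le> CARD('r) \<or> i = k"
  shows "da v n = (if Suc n = k then real (j - i) else 0)"
    "db v n = (if Suc n = i then real (j - k) else if Suc n = j then real (k - i) else 0)"
    "ps v n = (if n \<le> i \<or> j \<le> n then 0 else if n \<le> k then real (n - i) * real (j - k)
               else real (j - n) * real (k - i))"
    "v \<in> lattice_points"
proof -
  have x: "xc v n = (if n < k then real (j - i) else 0)" for n
    using assms by (auto simp: xc_def real_vec_def ray_x_def)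
  have y: "yc v n = (if n < i then real (j - i) else if n < j then real (k - i) else 0)" for n
    using assms by (auto simp: yc_def real_vec_def ray_y_def)
  show da: "da v n = (if Suc n = k then real (j - i) else 0)" for n
    by (auto simp: da_def x)
  show db: "db v n = (if Suc n = i then real (j - k) else if Suc n = j then real (k - i) else 0)" for n
    using assms(2,3) by (auto simp: db_def y of_nat_diff)
  show ps: "ps v n = (if n \<le> i \<or> j \<le> n then 0 else if n \<le> k then real (n - i) * real (j - k)
               else real (j - n) * real (k - i))" for n
  proof (induction n)
    case (Suc n)
    consider "n < i" | "i \<le> n" "n < k" | "k \<le> n" "n < j" | "j \<le> n"
      by linarith
    then show ?case
    proof cases
      case 1
      then show ?thesis
        using assms(2,3) by (simp add: ps_Suc Suc.IH x y)
    next
      case 2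
      then show ?thesis
        using assms(2,3) by (auto simp: ps_Suc Suc.IH x y of_nat_diff algebra_simps)
    next
      case 3
      then have "n = i \<and> k = i \<or> n = k \<and> i < k \<or> k < n \<and> i < n"
        using assms(2) by linarith
      moreover have "Suc n < j \<or> j = Suc n"
        using 3 by linarith
      ultimately show ?thesis
        using assms(2,3) 3 by (auto simp: ps_Suc Suc.IH x y of_nat_diff algebra_simps)
    next
      case 4
      then show ?thesis
        using assms(2,3) by (simp add: ps_Suc Suc.IH x y)
    qed
  qed simp
  have "v \<in> ineq_cone"
  proof (rule ineq_coneI)
    show "ps v CARD('r) = 0"
      using assms(2-) by (auto simp: ps)
  qed (auto simp: da db ps)
  then show "v \<in> lattice_points"
    unfolding lattice_points_eq v_def by blast
qed

section \<open>Decomposition of a point of the cone into rays\<close>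

lemma finite_support: "p \<in> ineq_cone \<Longrightarrow> finite {j. con (p :: 'r::{finite,linorder} kostka_space) j \<noteq> 0}"
proof -
  assume p: "p \<in> ineq_cone"
  have "{j. con p j \<noteq> 0} \<subseteq> {..<CARD('r)} <+> {..<CARD('r)} <+> {..<CARD('r)}"
  proof
    fix j assume "j \<in> {j. con p j \<noteq> 0}"
    then show "j \<in> {..<CARD('r)} <+> {..<CARD('r)} <+> {..<CARD('r)}"
      using outside_range(3-5)[of _ p] ineq_coneD(4)[OF p]
      by (cases "(p, j)" rule: con.cases) (auto simp: not_le[symmetric])
  qed
  then show ?thesis
    by (rule finite_subset) simp
qed

text \<open>Choose a peak \<open>k\<close> at which \<open>a\<close> is positive and the zeros
  \<open>i\<close>, \<open>j\<close> of \<open>s\<close> nearest to it on either side. The tent on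
  \<open>i\<close>, \<open>k\<close>, \<open>j\<close> is nonzero only in inequalities that are
  strict at \<open>p\<close>.\<close>

lemma lattice_point_of_smaller_support:
  assumes p: "p \<in> ineq_cone" and "p \<noteq> (0 :: 'r::{finite,linorder} kostka_space)"
  shows "\<exists>v\<in>(lattice_points :: 'r kostka_space set). (\<exists>j. con v j > 0) \<and> (\<forall>j. con v j \<noteq> 0 \<longrightarrow> con p j > 0)"
proof -
  \<comment> \<open>If every \<open>a\<close> vanished, then \<open>x = 0\<close>, so
    \<open>s\<close> would be nonincreasing from \<open>0\<close> and nonnegative, hence
    \<open>0\<close>, and \<open>p\<close> would be \<open>0\<close>.\<close>
  have "\<exists>n<CARD('r). da p n > 0"
  proof (rule ccontr)
    assume "\<not> ?thesis"
    then have da0: "da p n = 0" if "n < CARD('r)" for n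
      using that ineq_coneD(1)[OF p, of n] by force
    have x0: "xc p n = 0" for n
      using xc_eq_sum_da[of n p] outside_range(1)[of n p] da0 by (cases "n \<le> CARD('r)") auto
    have "ps p (Suc n) \<le> ps p n" for n
      using yc_nonneg[OF p, of n] x0 by (simp add: ps_Suc)
    then have "ps p n \<le> ps p 0" for n
      by (rule lift_Suc_antimono_le) simp
    then have "ps p n = 0" for n
      using ineq_coneD(3)[OF p, of n] by (simp add: order.eq_iff)
    with da0 have "p = 0"
      by (intro eq_0_if_da_ps_0) auto
    with assms show False by simp
  qed
  then obtain n where n: "n < CARD('r)" "da p n > 0" by blast
  \<comment> \<open>The value \<open>da p n\<close> enters the second difference of \<open>s\<close>
    centred at \<open>Suc n\<close>, so the peak is placed there.\<close>
  define k where "k = Suc n"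
  define i where "i = Max {m. m \<le> k \<and> ps p m = 0}"
  have i: "i \<le> k" "ps p i = 0"
  proof -
    have "0 \<in> {m. m \<le> k \<and> ps p m = 0}"
      by simp
    then have "i \<in> {m. m \<le> k \<and> ps p m = 0}"
      unfolding i_def by (intro Max_in) auto
    then show "i \<le> k" "ps p i = 0"
      by simp_all
  qed
  have i_max: "ps p m > 0" if "i < m" "m \<le> k" for m
  proof -
    have "ps p m \<noteq> 0"
    proof
      assume "ps p m = 0"
      then have "m \<le> i"
        using that unfolding i_def by (intro Max_ge) auto
      with that show False by simp
    qed
    then show ?thesis
      using ineq_coneD(3)[OF p, of m] by simp
  qed
  \<comment> \<open>If \<open>s\<close> vanishes at \<open>k\<close>, the degenerate ray with
    \<open>j = k + 1\<close> is used. Otherwise \<open>j\<close> is the next zero of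
    \<open>s\<close>, which exists because \<open>s\<close> vanishes at
    \<open>CARD('r)\<close>.\<close>
  obtain j where j: "k < j" "j \<le> CARD('r) \<or> i = k" "i < k \<Longrightarrow> ps p j = 0"
    "\<And>m. k < m \<Longrightarrow> m < j \<Longrightarrow> ps p m > 0"
  proof (cases "i = k")
    case True
    show thesis
      by (rule that[of "Suc k"]) (use True in auto)
  next
    case False
    then have "ps p k > 0"
      using i i_max by simp
    then have "k \<noteq> CARD('r)"
      using ineq_coneD(4)[OF p] by auto
    then have k: "k < CARD('r)"
      using n unfolding k_def by linarith
    define j where "j = (LEAST m. k < m \<and> ps p m = 0)"
    have *: "k < CARD('r) \<and> ps p CARD('r) = 0"
      using k ineq_coneD(4)[OF p] by simp
    show thesis
    proof (rule that[of j])
      show "k < j" "ps p j = 0"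
        using LeastI[of "\<lambda>m. k < m \<and> ps p m = 0", OF *] by (auto simp: j_def)
      show "j \<le> CARD('r) \<or> i = k"
        using Least_le[of "\<lambda>m. k < m \<and> ps p m = 0", OF *] by (auto simp: j_def)
      show "ps p m > 0" if "k < m" "m < j" for m
        using not_less_Least[of m "\<lambda>m. k < m \<and> ps p m = 0"] that ineq_coneD(3)[OF p, of m]
        by (cases "ps p m = 0") (auto simp: j_def)
    qed
  qed
  define v where "v = ((real_vec (ray_x i k j), real_vec (ray_y i k j)) :: 'r kostka_space)"
  have "k \<le> CARD('r)"
    using n by (simp add: k_def)
  note ray = ray_coordinates[OF i(1) j(1) this j(2), folded v_def]
  show ?thesis
  proof (intro bexI[OF _ ray(4)] conjI exI[of _ "Inl n"] allI impI)
    show "0 < con v (Inl n)"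
      using i j by (simp add: ray k_def)
    fix c assume c: "con v c \<noteq> 0"
    show "0 < con p c"
    proof (cases "(p, c)" rule: con.cases)
      case (1 p' m)
      then show ?thesis
        using c n by (auto simp: ray k_def split: if_splits)
    next
      case (2 p' m)
      then have "Suc m = i \<or> Suc m = j \<and> i < k"
        using c by (auto simp: ray split: if_splits)
      \<comment> \<open>This is \<open>db p m\<close>. At a foot of a proper tent \<open>s\<close>
        vanishes and is positive at the neighbour on the side of the peak; in the degenerate case
        \<open>da p n\<close> is the positive term.\<close>
      then have "ps p m + ps p (Suc (Suc m)) - 2 * ps p (Suc m) + da p m > 0"
      proof
        assume m: "Suc m = i"
        show ?thesis
        proof (cases "i = k")
          case True
          then show ?thesis
            using m n i(2) ineq_coneD(3)[OF p, of m] ineq_coneD(3)[OF p, of "Suc (Suc m)"]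
            by (simp add: k_def)
        next
          case False
          then show ?thesis
            using m i i_max[of "Suc (Suc m)"] ineq_coneD(3)[OF p, of m] ineq_coneD(1)[OF p, of m]
            by (simp add: k_def)
        qed
      next
        assume m: "Suc m = j \<and> i < k"
        then have "ps p m > 0"
          using j(1) j(4)[of m] i_max[of m] by (cases "k = m") auto
        then show ?thesis
          using m j(3) ineq_coneD(3)[OF p, of "Suc (Suc m)"] ineq_coneD(1)[OF p, of m] by simp
      qed
      then show ?thesis
        using 2 by (simp add: db_eq)
    next
      case (3 p' m)
      then have "i < m" "m < j"
        using c by (auto simp: ray split: if_splits)
      then show ?thesis
        using 3 i_max[of m] j(4)[of m] by (cases "m \<le> k") auto
    qed
  qed
qed

text \<open>Subtracting the largest admissible multiple of such a lattice point makes a further inequality tight.\<close>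

lemma ineq_cone_subset_hull: "p \<in> ineq_cone \<Longrightarrow> p \<in> convex hull (lattice_points :: 'r::{finite,linorder} kostka_space set)"
proof (induction "card {j. con p j \<noteq> 0}" arbitrary: p rule: less_induct)
  case less
  show ?case
  proof (cases "p = 0")
    case True
    obtain v :: "'r kostka_space" where "v \<in> lattice_points"
      using ray_coordinates(4)[of 0 0 1, where ?'r = 'r] by auto
    then show ?thesis
      using hull_lattice_points_scale[OF hull_inc, of v 0] True by simp
  next
    case False
    then obtain v :: "'r kostka_space" and j where v: "v \<in> lattice_points" "con v j > 0" "\<And>j. con v j \<noteq> 0 \<Longrightarrow> con p j > 0"
      using lattice_point_of_smaller_support[OF less.prems] by blast
    have v_cone: "v \<in> ineq_cone"
      using v(1) by (auto simp: lattice_points_eq)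
    define T where "T = (\<lambda>j. con p j / con v j) ` {j. con v j \<noteq> 0}"
    define t where "t = Min T"
    have T: "finite T" "T \<noteq> {}"
      using v(2) finite_support[OF v_cone] by (auto simp: T_def intro!: exI[of _ j])
    have t_in: "t \<in> T" and t_le: "\<And>s. s \<in> T \<Longrightarrow> t \<le> s"
      using T by (auto simp: t_def)
    have "0 \<le> t"
      using t_in v(3) ineq_coneD(5)[OF v_cone] by (auto simp: T_def less_imp_le)
    define q where "q = p - t *\<^sub>R v"
    have con_q: "con q j = con p j - t * con v j" for j
      by (simp add: q_def con_linear)
    have q: "q \<in> ineq_cone"
    proof -
      have "0 \<le> con q j" for j
      proof (cases "con v j = 0")
        case False
        then have "0 < con v j"
          using ineq_coneD(5)[OF v_cone, of j] by simp
        moreover have "t \<le> con p j / con v j"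
          using False by (auto intro: t_le simp: T_def)
        ultimately show ?thesis
          by (simp add: con_q field_simps)
      qed (simp add: con_q ineq_coneD(5)[OF less.prems])
      moreover have "ps q CARD('r) = 0"
        using ineq_coneD(4)[OF v_cone] ineq_coneD(4)[OF less.prems] by (simp add: q_def ps_linear)
      ultimately show ?thesis
        by (simp add: ineq_cone_def)
    qed
    obtain j0 where j0: "con v j0 \<noteq> 0" "t = con p j0 / con v j0"
      using t_in by (auto simp: T_def)
    have "{j. con q j \<noteq> 0} \<subset> {j. con p j \<noteq> 0}"
    proof (rule psubsetI)
      show "{j. con q j \<noteq> 0} \<subseteq> {j. con p j \<noteq> 0}"
        using v(3) by (force simp: con_q)
      have "con q j0 = 0" "con p j0 \<noteq> 0"
        using j0 v(3)[of j0] by (auto simp: con_q)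
      then show "{j. con q j \<noteq> 0} \<noteq> {j. con p j \<noteq> 0}"
        by blast
    qed
    then have "q \<in> convex hull lattice_points"
      by (intro less.hyps psubset_card_mono finite_support less.prems q)
    moreover have "t *\<^sub>R v \<in> convex hull lattice_points"
      using v(1) \<open>0 \<le> t\<close> by (intro hull_lattice_points_scale hull_inc)
    ultimately have "q + t *\<^sub>R v \<in> convex hull lattice_points"
      by (rule hull_lattice_points_add)
    then show ?thesis
      by (simp add: q_def)
  qed
qed

lemma kostka_cone_eq: "kostka_cone = ineq_cone"
proof
  have "convex hull lattice_points \<subseteq> ineq_cone"
    by (rule hull_minimal) (auto simp: lattice_points_eq convex_ineq_cone)
  then show "kostka_cone \<subseteq> ineq_cone"
    by (simp add: kostka_cone_def lattice_points_def)
  show "ineq_cone \<subseteq> kostka_cone"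
    using ineq_cone_subset_hull by (auto simp: kostka_cone_def lattice_points_def)
qed

subsection \<open>The word of a point\<close>

text \<open>At a zero of \<open>s\<close> the vanishing of \<open>b\<close> is not recorded: for a
  point of the cone, \<open>b\<close> is there a sum of the nonnegative \<open>a\<close> and
  neighbouring values of \<open>s\<close>, so these decide it.\<close>

definition letter_of :: "'r::{finite,linorder} kostka_space \<Rightarrow> nat \<Rightarrow> letter" where
  "letter_of p n =
    (if ps p (Suc n) = 0 then if da p n = 0 then Zero_tight else Zero_slack
     else if da p n = 0 then if db p n = 0 then Flat else Convex
     else if db p n = 0 then Concave else Slack)"

definition word :: "'r::{finite,linorder} kostka_space \<Rightarrow> letter list" where
  "word p = map (letter_of p) [0..<CARD('r)]"

lemma length_word [simp]: "length (word (p :: 'r::{finite,linorder} kostka_space)) = CARD('r)"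
  by (simp add: word_def)

lemma nth_word [simp]: "n < CARD('r) \<Longrightarrow> word (p :: 'r::{finite,linorder} kostka_space) ! n = letter_of p n"
  by (simp add: word_def)

lemma zero_letter_of: "zero_letter (letter_of p n) \<longleftrightarrow> ps p (Suc n) = 0"
  by (simp add: letter_of_def)

lemma bump_letter_of: "bump_letter (letter_of p n) \<longleftrightarrow> ps p (Suc n) \<noteq> 0 \<and> da p n \<noteq> 0"
  by (simp add: letter_of_def)

lemma accepts_word:
  assumes p: "p \<in> ineq_cone"
  shows "accepts Outside (word (p :: 'r::{finite,linorder} kostka_space))"
proof -
  \<comment> \<open>without a bump, \<open>s\<close> is convex and so keeps the positive slope with which it left \<open>0\<close>\<close>
  define I where "I q n = (case q of Outside \<Rightarrow> ps p n = 0
    | Rising \<Rightarrow> 0 < ps p n \<and> ps p n < ps p (Suc n) | Inside \<Rightarrow> 0 < ps p n)" for q n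
  have "accepts q (drop n (word p))" if "n \<le> CARD('r)" "I q n" for q n
    using that
  proof (induction arbitrary: q rule: inc_induct)
    case base
    then show ?case
      using ineq_coneD(4)[OF p] by (cases q) (auto simp: I_def)
  next
    case (step n)
    have "drop n (word p) = letter_of p n # drop (Suc n) (word p)"
      using step.hyps by (metis Cons_nth_drop_Suc length_word nth_word)
    moreover have "\<not> (q = Rising \<and> zero_letter (letter_of p n))"
      using step.prems by (auto simp: I_def zero_letter_of)
    \<comment> \<open>For a letter that is neither a zero nor a bump, \<open>a = 0\<close> and
      \<open>b \<ge> 0\<close> make the next increment of \<open>s\<close> at least the current one.
      From \<open>Outside\<close> the current increment is positive because \<open>s\<close> has
      just left \<open>0\<close>.\<close>
    moreover have "I (step q (letter_of p n)) (Suc n)"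
      using step.prems ineq_coneD(3)[OF p, of "Suc n"] ineq_coneD(2)[OF p, of n] db_eq[of p n]
      by (cases q) (auto simp: I_def step_def zero_letter_of bump_letter_of)
    ultimately show ?case
      using step.IH by simp
  qed
  from this[of 0 Outside] show ?thesis
    by (simp add: I_def)
qed

subsection \<open>Strata and their dimension\<close>

text \<open>A discrete minimum principle. At the first position where a negative minimum is
  attained, concavity would force the left neighbour to attain it too.\<close>

lemma concave_off_zeros_nonneg:
  fixes S :: "nat \<Rightarrow> real"
  assumes "S 0 = 0" "S r = 0"
    and "\<And>n. Suc n < r \<Longrightarrow> S (Suc n) = 0 \<or> S n + S (Suc (Suc n)) \<le> 2 * S (Suc n)"
    and "n \<le> r"
  shows "0 \<le> S n"
proof (rule ccontr)
  assume neg: "\<not> 0 \<le> S n"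
  define m where "m = Min (S ` {..r})"
  have le: "m \<le> S k" if "k \<le> r" for k
    using that by (auto simp: m_def)
  have "m \<in> S ` {..r}"
    unfolding m_def by (rule Min_in) auto
  then obtain k0 where k0: "k0 \<le> r" "S k0 = m" by auto
  define k where "k = (LEAST k. S k = m)"
  have k: "S k = m" "k \<le> k0"
    unfolding k_def by (rule LeastI[of _ k0], rule k0, rule Least_le, rule k0)
  have "m < 0"
    using neg le[of n] assms(4) by simp
  with assms k obtain l where l: "k = Suc l"
    by (cases k) auto
  have "k \<noteq> r"
    using k \<open>m < 0\<close> assms by auto
  then have "Suc l < r"
    using k k0 l by simp
  then have "S l + S (Suc (Suc l)) \<le> 2 * m"
    using assms(3)[of l] \<open>m < 0\<close> k l by auto
  then have "S l = m"
    using le[of l] le[of "Suc (Suc l)"] \<open>Suc l < r\<close> by simp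
  then show False
    using not_less_Least[of l "\<lambda>k. S k = m"] l by (simp add: k_def)
qed

text \<open>
  By the minimum principle above, applied to \<open>s\<close> and \<open>-s\<close>, these coordinates are injective, hence
  bijective; each stratum becomes a coordinate subspace in them.
\<close>

definition chart :: "(nat \<Rightarrow> bool) \<Rightarrow> 'r::{finite,linorder} kostka_space \<Rightarrow> 'r kostka_space" where
  "chart Z p = (\<chi> i. da p (pos i), \<chi> i. if Z (pos i) then ps p (Suc (pos i)) else db p (pos i))"

lemma linear_chart: "linear (chart Z)"
  by (rule linearI) (auto simp: chart_def vec_eq_iff da_linear db_linear ps_linear)

lemma inj_chart:
  assumes Z: "Z (CARD('r) - 1)"
  shows "inj (chart Z :: 'r::{finite,linorder} kostka_space \<Rightarrow> _)"
  unfolding linear_injective_0[OF linear_chart]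
proof (intro allI impI)
  fix p :: "'r kostka_space" assume "chart Z p = 0"
  then have *: "da p (pos i) = 0" "(if Z (pos i) then ps p (Suc (pos i)) else db p (pos i)) = 0" for i :: 'r
    by (auto simp: chart_def vec_eq_iff zero_prod_def)
  have da: "da p n = 0" and psdb: "(if Z n then ps p (Suc n) else db p n) = 0" if "n < CARD('r)" for n
    using *[of "idx n"] that by (simp_all split: if_split_asm)
  have r: "ps p CARD('r) = 0"
    using psdb[of "CARD('r) - 1"] Z by simp
  \<comment> \<open>With \<open>a = 0\<close>, the equation \<open>b = 0\<close> says that
    \<open>s\<close> is discretely harmonic away from its prescribed zeros.\<close>
  have harmonic: "ps p (Suc n) = 0 \<or> ps p n + ps p (Suc (Suc n)) = 2 * ps p (Suc n)" if "Suc n < CARD('r)" for n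
    using psdb[of n] da[of n] db_eq[of p n] that by (auto split: if_splits)
  have "ps p n = 0" if "n \<le> CARD('r)" for n
  proof -
    have "0 \<le> ps p n"
      using r harmonic that by (intro concave_off_zeros_nonneg[of "ps p" "CARD('r)"]) force+
    moreover have "0 \<le> - ps p n"
      using r harmonic that by (intro concave_off_zeros_nonneg[of "\<lambda>n. - ps p n" "CARD('r)"]) force+
    ultimately show ?thesis by simp
  qed
  with da show "p = 0"
    by (intro eq_0_if_da_ps_0) auto
qed

lemma surj_chart: "Z (CARD('r) - 1) \<Longrightarrow> surj (chart Z :: 'r::{finite,linorder} kostka_space \<Rightarrow> _)"
  by (rule linear_injective_imp_surjective[OF linear_chart inj_chart]) simp_all

lemma ex_prescribed_chart:
  assumes "Z (CARD('r) - 1)"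
  shows "\<exists>p :: 'r::{finite,linorder} kostka_space. \<forall>n<CARD('r). da p n = \<alpha> n \<and>
    (if Z n then ps p (Suc n) else db p n) = \<beta> n"
proof -
  obtain p :: "'r kostka_space" where p: "chart Z p = (\<chi> i. \<alpha> (pos i), \<chi> i. \<beta> (pos i))"
    using surj_chart[of Z, OF assms] by (metis surjD)
  have *: "da p (pos i) = \<alpha> (pos i)"
    "(if Z (pos i) then ps p (Suc (pos i)) else db p (pos i)) = \<beta> (pos i)" for i :: 'r
    using p by (auto simp: chart_def vec_eq_iff)
  have "da p n = \<alpha> n \<and> (if Z n then ps p (Suc n) else db p n) = \<beta> n" if "n < CARD('r)" for n
    using *[of "idx n"] pos_idx[OF that] by (simp split: if_split_asm)
  then show ?thesis by blast
qed

text \<open>\<open>free_x\<close> and \<open>free_y\<close> tell which of the two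
  \<open>chart\<close> coordinates at a position may be nonzero. The second is never free at a zero
  letter.\<close>

fun free_x :: "letter \<Rightarrow> bool" where
  "free_x Zero_slack = True"
| "free_x Concave = True"
| "free_x Slack = True"
| "free_x _ = False"

fun free_y :: "letter \<Rightarrow> bool" where
  "free_y Convex = True"
| "free_y Slack = True"
| "free_y _ = False"

text \<open>Keeps only the equations encoded by the word and drops the strict inequalities, which
  leaves a linear subspace.\<close>

definition stratum :: "letter list \<Rightarrow> 'r::{finite,linorder} kostka_space set" where
  "stratum w = {p. \<forall>n<CARD('r). (\<not> free_x (w ! n) \<longrightarrow> da p n = 0) \<and>
     (\<not> free_y (w ! n) \<longrightarrow> (if zero_letter (w ! n) then ps p (Suc n) else db p n) = 0)}"

lemma letter_weight_eq: "letter_weight c = of_bool (free_x c) + of_bool (free_y c)"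
  by (cases c) simp_all

lemma word_weight_eq:
  assumes "length w = CARD('r)"
  shows "word_weight w = card {i :: 'r::{finite,linorder}. free_x (w ! pos i)} + card {i :: 'r. free_y (w ! pos i)}"
proof -
  have "word_weight w = (\<Sum>n<CARD('r). letter_weight (w ! n))"
    using assms by (simp add: word_weight_def sum_list_sum_nth atLeast0LessThan)
  also have "\<dots> = (\<Sum>i\<in>(UNIV :: 'r set). letter_weight (w ! pos i))"
    by (simp add: sum_UNIV_idx)
  also have "\<dots> = (\<Sum>i\<in>(UNIV :: 'r set). of_bool (free_x (w ! pos i))) + (\<Sum>i\<in>(UNIV :: 'r set). of_bool (free_y (w ! pos i)))"
    by (simp add: letter_weight_eq sum.distrib)
  finally show ?thesis
    by (simp add: Collect_conj_eq)
qed

lemma dim_coordinate_subspace: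
  fixes I J :: "'n::finite set"
  shows "dim {(x :: real ^ 'n, y :: real ^ 'n). \<forall>i. (i \<notin> I \<longrightarrow> x $ i = 0) \<and> (i \<notin> J \<longrightarrow> y $ i = 0)} = card I + card J"
proof -
  define d :: "((real ^ 'n) \<times> (real ^ 'n)) set"
    where "d = (\<lambda>i. (axis i 1, 0)) ` I \<union> (\<lambda>i. (0, axis i 1)) ` J"
  have ne: "axis i (1::real) \<noteq> 0" for i :: 'n
    by (simp add: axis_eq_0_iff)
  have "{(x :: real ^ 'n, y :: real ^ 'n). \<forall>i. (i \<notin> I \<longrightarrow> x $ i = 0) \<and> (i \<notin> J \<longrightarrow> y $ i = 0)}
    = {x. \<forall>b\<in>Basis. b \<notin> d \<longrightarrow> x \<bullet> b = 0}"
    (is "?V = ?B")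
  proof (intro equalityI subsetI)
    fix z assume "z \<in> ?V"
    then show "z \<in> ?B"
      by (auto simp: Basis_prod_def Basis_vec_def d_def inner_axis axis_eq_axis)
  next
    fix z assume z: "z \<in> ?B"
    have "fst z $ i = 0" if "i \<notin> I" for i
    proof -
      have "(axis i (1::real), 0 :: real ^ 'n) \<in> Basis" "(axis i 1, 0) \<notin> d"
        using that ne by (auto simp: Basis_prod_def axis_in_Basis_iff d_def axis_eq_axis)
      then have "z \<bullet> (axis i 1, 0) = 0"
        using z by blast
      then show ?thesis
        by (simp add: inner_prod_def inner_axis)
    qed
    moreover have "snd z $ i = 0" if "i \<notin> J" for i
    proof -
      have "(0 :: real ^ 'n, axis i (1::real)) \<in> Basis" "(0, axis i 1) \<notin> d"
        using that ne by (auto simp: Basis_prod_def axis_in_Basis_iff d_def axis_eq_axis)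
      then have "z \<bullet> (0, axis i 1) = 0"
        using z by blast
      then show ?thesis
        by (simp add: inner_prod_def inner_axis)
    qed
    ultimately show "z \<in> ?V"
      by (auto simp: case_prod_beta)
  qed
  also have "dim \<dots> = card d"
    by (rule dim_substandard) (auto simp: Basis_prod_def Basis_vec_def d_def)
  also have "\<dots> = card I + card J"
    unfolding d_def using ne
    by (subst card_Un_disjoint) (auto simp: card_image inj_on_def axis_eq_axis)
  finally show ?thesis .
qed

lemma subspace_stratum: "subspace (stratum w)"
proof (rule subspaceI)
  show "p + q \<in> stratum w" if "p \<in> stratum w" "q \<in> stratum w" for p q
    using that unfolding stratum_def da_linear db_linear ps_linear mem_Collect_eq by (smt (verit))
  show "c *\<^sub>R p \<in> stratum w" if "p \<in> stratum w" for c p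
    using that unfolding stratum_def da_linear db_linear ps_linear mem_Collect_eq
    by (metis mult_zero_right)
qed (simp add: stratum_def)

text \<open>The final zero letter makes \<open>chart\<close> bijective, and \<open>chart\<close>
  carries the stratum onto a coordinate subspace with one axis per free coordinate.\<close>

lemma dim_stratum:
  assumes "length w = CARD('r)" "zero_letter (w ! (CARD('r) - 1))"
  shows "dim (stratum w :: 'r::{finite,linorder} kostka_space set) = word_weight w"
proof -
  define Z where "Z n = zero_letter (w ! n)" for n
  define V :: "'r kostka_space set" where "V = {(x, y). \<forall>i. (i \<notin> {i. free_x (w ! pos i)} \<longrightarrow> x $ i = 0)
    \<and> (i \<notin> {i. free_y (w ! pos i)} \<longrightarrow> y $ i = 0)}"
  have Z: "Z (CARD('r) - 1)"
    using assms by (simp add: Z_def)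
  have "stratum w = chart Z -` V"
  proof (intro set_eqI)
    fix p :: "'r kostka_space"
    show "p \<in> stratum w \<longleftrightarrow> p \<in> chart Z -` V"
      unfolding stratum_def V_def chart_def Z_def vimage_def
      by (auto simp del: if_split_asm) (metis pos_idx pos_less)+
  qed
  then have "chart Z ` stratum w = V"
    using surj_chart[of Z, OF Z] by auto
  then have "dim (stratum w :: 'r kostka_space set) = dim V"
    using dim_image_eq[OF linear_chart, of Z "stratum w :: 'r kostka_space set"] inj_chart[of Z, OF Z]
    by (metis inj_on_subset subset_UNIV)
  also have "\<dots> = word_weight w"
    unfolding V_def dim_coordinate_subspace word_weight_eq[OF assms(1)] ..
  finally show ?thesis .
qed

section \<open>Realising accepted words by points of the cone\<close>

lemma accepts_last_zero: "accepts q w \<Longrightarrow> w \<noteq> [] \<Longrightarrow> zero_letter (last w)"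
  by (induction w arbitrary: q) (auto simp: step_def split: if_splits)

lemma ex_small_perturbation:
  fixes f g :: "'a \<Rightarrow> real"
  assumes "finite J" "\<And>j. j \<in> J \<Longrightarrow> 0 < f j"
  shows "\<exists>e>0. \<forall>j\<in>J. 0 < f j + e * g j"
proof -
  have "\<forall>\<^sub>F e in at_right 0. 0 < f j + e * g j" if "j \<in> J" for j
  proof (rule order_tendstoD(1))
    show "((\<lambda>e. f j + e * g j) \<longlongrightarrow> f j + 0 * g j) (at_right 0)"
      by (intro tendsto_intros)
  qed (use assms that in simp)
  then have "\<forall>\<^sub>F e in at_right 0. \<forall>j\<in>J. 0 < f j + e * g j"
    using assms(1) by (simp add: eventually_ball_finite)
  then have "\<forall>\<^sub>F e in at_right (0::real). 0 < e \<and> (\<forall>j\<in>J. 0 < f j + e * g j)"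
    using eventually_at_right_less by (rule eventually_conj[rotated])
  then show ?thesis
    using eventually_happens[of _ "at_right (0::real)"] by auto
qed

text \<open>If the nonnegative \<open>S\<close> vanishes at a nonzero letter, concavity makes it
  vanish at both neighbours and excludes a bump there. Vanishing thus spreads to the right, the
  automaton stays in \<open>Rising\<close> up to the closing zero letter, and it rejects.\<close>

lemma concave_positive_on_accepted:
  fixes S :: "nat \<Rightarrow> real"
  assumes "accepts Outside w"
    and zero: "\<And>n. n < length w \<Longrightarrow> zero_letter (w ! n) \<Longrightarrow> S (Suc n) = 0"
    and concave: "\<And>n. n < length w \<Longrightarrow> \<not> zero_letter (w ! n) \<Longrightarrow>
      S n + S (Suc (Suc n)) + of_bool (bump_letter (w ! n)) = 2 * S (Suc n)"
    and nonneg: "\<And>n. n \<le> length w \<Longrightarrow> 0 \<le> S n"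
    and n: "n < length w" "\<not> zero_letter (w ! n)"
  shows "0 < S (Suc n)"
proof -
  have last: "Suc n < length w" if "n < length w" "\<not> zero_letter (w ! n)" for n
  proof (rule ccontr)
    assume "\<not> ?thesis"
    then have "n = length w - 1" "w \<noteq> []"
      using that by auto
    with that accepts_last_zero[OF assms(1)] show False
      by (simp add: last_conv_nth)
  qed
  have flat: "S n = 0 \<and> S (Suc (Suc n)) = 0 \<and> \<not> bump_letter (w ! n)"
    if "n < length w" "\<not> zero_letter (w ! n)" "S (Suc n) = 0" for n
    using concave[OF that(1,2)] that(3) nonneg[of n] nonneg[of "Suc (Suc n)"] last[OF that(1,2)]
    by (cases "bump_letter (w ! n)") auto
  have drop: "drop n w = w ! n # drop (Suc n) w" if "n < length w" for n
    using that by (simp add: Cons_nth_drop_Suc)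
  have rising: "S (Suc n) = 0 \<Longrightarrow> \<not> accepts Rising (drop n w)" if "n \<le> length w" for n
    using that
  proof (induction rule: inc_induct)
    case (step n)
    show ?case
    proof
      assume acc: "accepts Rising (drop n w)"
      then have nz: "\<not> zero_letter (w ! n)" "accepts (step Rising (w ! n)) (drop (Suc n) w)"
        using step.hyps by (auto simp: drop)
      with flat[OF step.hyps(2) nz(1) step.prems] step.IH show False
        by (simp add: step_def)
    qed
  qed simp
  \<comment> \<open>Invariant of the scan: \<open>S\<close> is positive whenever the state is not
    \<open>Outside\<close>. A vanishing value can therefore only appear at the first letter of a
    run.\<close>
  have "\<forall>m. n \<le> m \<and> m < length w \<and> \<not> zero_letter (w ! m) \<longrightarrow> 0 < S (Suc m)"
    if "n \<le> length w" "accepts q (drop n w)" "q \<noteq> Outside \<Longrightarrow> 0 < S n" for n q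
    using that
  proof (induction arbitrary: q rule: inc_induct)
    case (step n)
    have acc: "accepts (step q (w ! n)) (drop (Suc n) w)"
      using step.prems(1) step.hyps by (simp add: drop)
    have pos: "0 < S (Suc n)" if nz: "\<not> zero_letter (w ! n)"
    proof (rule ccontr)
      assume "\<not> 0 < S (Suc n)"
      then have 0: "S (Suc n) = 0"
        using nonneg[of "Suc n"] step.hyps by simp
      note fl = flat[OF step.hyps(2) nz 0]
      have "q = Outside"
        using fl step.prems(2) by force
      then have "accepts Rising (drop (Suc n) w)"
        using acc fl nz by (simp add: step_def)
      then show False
        using rising[of "Suc n"] fl step.hyps by simp
    qed
    have "\<forall>m. Suc n \<le> m \<and> m < length w \<and> \<not> zero_letter (w ! m) \<longrightarrow> 0 < S (Suc m)"
      using pos by (intro step.IH[OF acc]) (auto simp: step_def split: if_splits)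
    then show ?case
      using pos by (metis Suc_leI le_neq_implies_less)
  qed simp
  from this[of 0 Outside] assms show ?thesis
    by simp
qed

lemma ex_point_of_word:
  assumes acc: "accepts Outside w" and len: "length w = CARD('r)"
  shows "\<exists>p\<in>ineq_cone. word (p :: 'r::{finite,linorder} kostka_space) = w"
proof -
  have "w \<noteq> []"
    using len by auto
  then have Z: "zero_letter (w ! (CARD('r) - 1))"
    using accepts_last_zero[OF acc] len by (simp add: last_conv_nth)
  \<comment> \<open>\<open>u\<close> has \<open>s > 0\<close> off the zeros and the right \<open>a\<close>; a small multiple of \<open>v\<close> supplies the convex letters\<close>
  obtain u :: "'r kostka_space" where u: "\<forall>n<CARD('r).
      da u n = of_bool (free_x (w ! n)) + of_bool (w ! n = Slack) \<and>
      (if zero_letter (w ! n) then ps u (Suc n) else db u n) = of_bool (w ! n = Slack)"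
    using ex_prescribed_chart[where ?'r = 'r and Z = "\<lambda>n. zero_letter (w ! n)"
      and \<alpha> = "\<lambda>n. of_bool (free_x (w ! n)) + of_bool (w ! n = Slack)"
      and \<beta> = "\<lambda>n. of_bool (w ! n = Slack)", OF Z] by blast
  obtain v :: "'r kostka_space" where v: "\<forall>n<CARD('r). da v n = 0 \<and>
      (if zero_letter (w ! n) then ps v (Suc n) else db v n) = of_bool (w ! n = Convex)"
    using ex_prescribed_chart[where ?'r = 'r and Z = "\<lambda>n. zero_letter (w ! n)" 
      and \<alpha> = "\<lambda>n. 0" and \<beta> = "\<lambda>n. of_bool (w ! n = Convex)", OF Z] by blast
  have zero: "ps u (Suc n) = 0" "ps v (Suc n) = 0" if "n < CARD('r)" "zero_letter (w ! n)" for n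
    using u[rule_format, OF that(1)] v[rule_format, OF that(1)] that(2) by auto
  \<comment> \<open>The pair of \<open>a\<close> and \<open>b\<close> is \<open>2\<close>,
    \<open>1\<close> at \<open>Slack\<close>, \<open>1\<close>, \<open>0\<close> at
    \<open>Concave\<close> and \<open>0\<close>, \<open>0\<close> at \<open>Flat\<close> and
    \<open>Convex\<close>; the difference is the bump term.\<close>
  have bump: "ps u n + ps u (Suc (Suc n)) + of_bool (bump_letter (w ! n)) = 2 * ps u (Suc n)"
    if "n < CARD('r)" "\<not> zero_letter (w ! n)" for n
    using db_eq[of u n] u[rule_format, OF that(1)] that(2) by (cases "w ! n") auto
  have r0: "ps u CARD('r) = 0" "ps v CARD('r) = 0"
    using zero[of "CARD('r) - 1"] Z by simp_all
  have nonneg: "0 \<le> ps u n" if "n \<le> CARD('r)" for n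
  proof (rule concave_off_zeros_nonneg[of "ps u" "CARD('r)"])
    show "ps u (Suc n) = 0 \<or> ps u n + ps u (Suc (Suc n)) \<le> 2 * ps u (Suc n)" if "Suc n < CARD('r)" for n
      using zero(1)[of n] bump[of n] that by (cases "zero_letter (w ! n)") (auto simp: of_bool_def split: if_splits)
  qed (use r0 that in auto)
  have pos: "0 < ps u (Suc n)" if "n < CARD('r)" "\<not> zero_letter (w ! n)" for n
    by (rule concave_positive_on_accepted[OF acc, of "ps u"]) (use zero bump nonneg that len in auto)
  \<comment> \<open>Adding a multiple of \<open>v\<close> may lower \<open>s\<close> at nonzero
    letters, so the multiple must be small enough to keep \<open>s\<close> positive there.\<close>
  obtain e where e: "e > 0" "\<And>n. n < CARD('r) \<Longrightarrow> \<not> zero_letter (w ! n) \<Longrightarrow> 0 < ps u (Suc n) + e * ps v (Suc n)"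
    using ex_small_perturbation[of "{n. n < CARD('r) \<and> \<not> zero_letter (w ! n)}" "\<lambda>n. ps u (Suc n)" "\<lambda>n. ps v (Suc n)"] pos
    by auto
  define p where "p = u + e *\<^sub>R v"
  have ps_p: "ps p n = ps u n + e * ps v n" for n
    by (simp add: p_def ps_linear)
  have psp_pos: "0 < ps p (Suc n)" if "n < CARD('r)" "\<not> zero_letter (w ! n)" for n
    using e(2)[OF that] by (simp add: ps_p)
  have psp_zero: "ps p (Suc n) = 0" if "n < CARD('r)" "zero_letter (w ! n)" for n
    using zero[OF that] by (simp add: ps_p)
  have dap: "da p n = of_bool (free_x (w ! n)) + of_bool (w ! n = Slack)" if "n < CARD('r)" for n
    using u v that by (simp add: p_def da_linear)
  have dbp: "db p n = of_bool (w ! n = Slack) + e * of_bool (w ! n = Convex)" if "n < CARD('r)" "\<not> zero_letter (w ! n)" for n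
    using u[rule_format, OF that(1)] v[rule_format, OF that(1)] that(2) by (simp add: p_def db_linear)
  have psp: "0 \<le> ps p n" for n
  proof (cases "CARD('r) \<le> n")
    case True
    then show ?thesis
      using outside_range(5)[of n p] r0 by (simp add: ps_p)
  next
    case False
    then show ?thesis
      using psp_pos[of "n - 1"] psp_zero[of "n - 1"]
      by (cases n; cases "zero_letter (w ! (n - 1))") auto
  qed
  have "p \<in> ineq_cone"
  proof (rule ineq_coneI)
    show da: "0 \<le> da p n" for n
      using dap[of n] outside_range(3)[of n p] by (cases "n < CARD('r)") auto
    show "0 \<le> db p n" for n
    proof (cases "n < CARD('r) \<and> \<not> zero_letter (w ! n)")
      case True
      then show ?thesis
        using dbp[of n] e(1) by simp
    next
      case False
      \<comment> \<open>At a zero of \<open>s\<close> the value of \<open>b\<close> was not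
        prescribed; there it is nonnegative by \<open>db_eq\<close>.\<close>
      then have "ps p (Suc n) = 0 \<or> CARD('r) \<le> n"
        using psp_zero[of n] by auto
      then show ?thesis
        using db_eq[of p n] da[of n] psp[of n] psp[of "Suc (Suc n)"] outside_range(4)[of n p] by auto
    qed
    show "ps p CARD('r) = 0"
      using r0 by (simp add: ps_p)
  qed (rule psp)
  moreover have "word p = w"
  proof (rule nth_equalityI)
    fix n assume "n < length (word p)"
    then have n: "n < CARD('r)" by simp
    show "word p ! n = w ! n"
      using psp_pos[OF n] psp_zero[OF n] dap[OF n] dbp[OF n] n e(1)
      by (cases "w ! n") (auto simp: letter_of_def)
  qed (simp add: len)
  ultimately show ?thesis by blast
qed

subsection \<open>Faces of the polytope\<close>

definition coord_total :: "'r::{finite,linorder} kostka_space \<Rightarrow> real" where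
  "coord_total p = (\<Sum>i\<in>UNIV. fst p $ i + snd p $ i)"

lemma coord_total_linear: "coord_total (p + q) = coord_total p + coord_total q" "coord_total (c *\<^sub>R p) = c * coord_total p"
    "coord_total (p - q) = coord_total p - coord_total q"
  by (simp_all add: coord_total_def sum.distrib sum_subtractf sum_distrib_left algebra_simps)

lemma kostka_polytope_eq: "kostka_polytope = {p \<in> ineq_cone. coord_total p = 1}"
  by (auto simp: kostka_polytope_def kostka_cone_eq coord_total_def)

lemma coord_total_pos:
  assumes p: "p \<in> ineq_cone" "p \<noteq> (0 :: 'r::{finite,linorder} kostka_space)"
  shows "0 < coord_total p"
proof -
  have *: "coord_total p = (\<Sum>n<CARD('r). xc p n + yc p n)"
    by (simp add: coord_total_def sum_UNIV_idx xc_def yc_def)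
  have "coord_total p \<noteq> 0"
  proof
    assume "coord_total p = 0"
    then have "\<forall>n<CARD('r). xc p n + yc p n = 0"
      unfolding * using xc_nonneg[OF p(1)] yc_nonneg[OF p(1)]
      by (subst (asm) sum_nonneg_eq_0_iff) (auto intro: add_nonneg_nonneg)
    then have "xc p n = 0 \<and> yc p n = 0" for n
      using xc_nonneg[OF p(1), of n] yc_nonneg[OF p(1), of n] outside_range(1,2)[of n p]
      by (cases "n < CARD('r)") (auto simp: add_nonneg_eq_0_iff)
    then have "p = 0"
      by (intro kostka_space_eqI) auto
    with p show False by simp
  qed
  moreover have "0 \<le> coord_total p"
    unfolding * using xc_nonneg[OF p(1)] yc_nonneg[OF p(1)] by (auto intro!: sum_nonneg add_nonneg_nonneg)
  ultimately show ?thesis by simp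
qed

text \<open>The word is constant along rays, so a point of the cone can be rescaled to total
  \<open>1\<close>. Positive weight rules out the apex.\<close>

lemma ex_polytope_point_of_word:
  assumes "accepts Outside w" "length w = CARD('r)" "0 < word_weight w"
  shows "\<exists>p\<in>kostka_polytope. word (p :: 'r::{finite,linorder} kostka_space) = w"
proof -
  obtain p :: "'r kostka_space" where p: "p \<in> ineq_cone" "word p = w"
    using ex_point_of_word[OF assms(1,2)] by blast
  have "p \<noteq> 0"
  proof
    assume "p = 0"
    then have "letter_of p n = Zero_tight" for n
      by (simp add: letter_of_def)
    then have "word_weight w = 0"
      unfolding p(2)[symmetric] by (simp add: word_def word_weight_def)
    with assms show False by simp
  qed
  with p have t: "0 < coord_total p"
    using coord_total_pos by blast
  define q where "q = (1 / coord_total p) *\<^sub>R p"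
  have "q \<in> kostka_polytope"
    using t p(1) by (auto simp: kostka_polytope_eq q_def coord_total_linear intro: ineq_cone_scale)
  moreover have "word q = w"
    using t unfolding p(2)[symmetric]
    by (simp add: word_def letter_of_def q_def da_linear db_linear ps_linear)
  ultimately show ?thesis by blast
qed

text \<open>Finitely many inequalities are strict at \<open>x\<close> and survive a short move; the
  tight ones are unchanged by \<open>d\<close>. The equation for \<open>s\<close> at
  \<open>CARD('r)\<close> is among the tight ones.\<close>

lemma ineq_cone_move:
  assumes x: "x \<in> ineq_cone" and "\<And>j. con x j = 0 \<Longrightarrow> con d j = 0"
  shows "\<exists>e>0. x + e *\<^sub>R d \<in> (ineq_cone :: 'r::{finite,linorder} kostka_space set)"
proof -
  have "0 < con x j" if "con x j \<noteq> 0" for j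
    using that ineq_coneD(5)[OF x, of j] by simp
  then obtain e where e: "e > 0" "\<And>j. con x j \<noteq> 0 \<Longrightarrow> 0 < con x j + e * con d j"
    using ex_small_perturbation[OF finite_support[OF x], of "con x" "con d"] by auto
  have "0 \<le> con (x + e *\<^sub>R d) j" for j
    using e(2)[of j] assms(2)[of j] by (cases "con x j = 0") (auto simp: con_linear)
  moreover have "ps (x + e *\<^sub>R d) CARD('r) = 0"
    using assms(2)[of "Inr (Inr CARD('r))"] ineq_coneD(4)[OF x] by (simp add: ps_linear)
  ultimately show ?thesis
    using e(1) by (auto simp: ineq_cone_def)
qed

text \<open>The stratum omits the equation \<open>b = 0\<close> at zeros of \<open>s\<close>. It
  follows from the others: if \<open>b\<close> vanishes there at \<open>x\<close>, so do
  \<open>a\<close> and both neighbouring values of \<open>s\<close>, being nonnegative terms with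
  sum \<open>b\<close>.\<close>

lemma stratum_word_iff:
  fixes x q :: "'r::{finite,linorder} kostka_space"
  assumes x: "x \<in> ineq_cone"
  shows "q \<in> stratum (word x) \<longleftrightarrow> (\<forall>j. con x j = 0 \<longrightarrow> con q j = 0)"
proof
  assume "\<forall>j. con x j = 0 \<longrightarrow> con q j = 0"
  then have "da x n = 0 \<Longrightarrow> da q n = 0" "db x n = 0 \<Longrightarrow> db q n = 0" "ps x n = 0 \<Longrightarrow> ps q n = 0" for n
    by (metis con.simps)+
  then show "q \<in> stratum (word x)"
    by (auto simp: stratum_def letter_of_def)
next
  assume q: "q \<in> stratum (word x)"
  have da: "da q n = 0" if "da x n = 0" for n
    using q that outside_range(3)[of n q]
    by (cases "n < CARD('r)") (auto simp: stratum_def letter_of_def)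
  have ps_Suc: "ps q (Suc n) = 0" if "ps x (Suc n) = 0" "n < CARD('r)" for n
    using q that by (auto simp: stratum_def letter_of_def split: if_splits)
  have r: "ps q CARD('r) = 0"
    using ps_Suc[of "CARD('r) - 1"] ineq_coneD(4)[OF x] by simp
  have ps: "ps q n = 0" if "ps x n = 0" for n
    using ps_Suc[of "n - 1"] that outside_range(5)[of n q] r by (cases n; cases "n \<le> CARD('r)") auto
  have db: "db q n = 0" if "db x n = 0" for n
  proof (cases "ps x (Suc n) = 0")
    case True
    then have "da x n = 0" "ps x n = 0" "ps x (Suc (Suc n)) = 0"
      using db_eq[of x n] that ineq_coneD(1)[OF x, of n] ineq_coneD(3)[OF x, of n]
        ineq_coneD(3)[OF x, of "Suc (Suc n)"] by auto
    with True show ?thesis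
      by (simp add: db_eq da ps)
  next
    case False
    then show ?thesis
      using q that outside_range(4)[of n q]
      by (cases "n < CARD('r)") (auto simp: stratum_def letter_of_def split: if_splits)
  qed
  show "\<forall>j. con x j = 0 \<longrightarrow> con q j = 0"
    using da db ps by (auto simp: split_sum_all)
qed

section \<open>Correspondence between faces and words\<close>

definition face :: "letter list \<Rightarrow> 'r::{finite,linorder} kostka_space set" where
  "face w = kostka_polytope \<inter> stratum w"

lemma face_word_eq:
  fixes x :: "'r::{finite,linorder} kostka_space"
  assumes "x \<in> kostka_polytope"
  shows "(face (word x) :: 'r kostka_space set) = {q \<in> kostka_polytope. \<forall>j. con x j = 0 \<longrightarrow> con q j = 0}"
proof -
  have "x \<in> ineq_cone"
    using assms by (simp add: kostka_polytope_eq)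
  from stratum_word_iff[OF this] show ?thesis
    by (auto simp: face_def)
qed

lemma convex_kostka_polytope: "convex kostka_polytope"
  by (rule convexI) (simp add: kostka_polytope_eq ineq_cone_add ineq_cone_scale coord_total_linear)

lemma face_word_face_of:
  fixes x :: "'r::{finite,linorder} kostka_space"
  assumes x: "x \<in> kostka_polytope"
  shows "(face (word x) :: 'r kostka_space set) face_of kostka_polytope"
  unfolding face_of_def
proof (intro conjI ballI impI)
  show "face (word x) \<subseteq> (kostka_polytope :: 'r kostka_space set)"
    by (simp add: face_def)
  show "convex (face (word x) :: 'r kostka_space set)"
    unfolding face_def
    by (intro convex_Int convex_kostka_polytope subspace_imp_convex subspace_stratum)
  fix a b z :: "'r kostka_space"
  assume ab: "a \<in> kostka_polytope" "b \<in> kostka_polytope" and z: "z \<in> face (word x)" "z \<in> open_segment a b"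
  obtain t where t: "z = (1 - t) *\<^sub>R a + t *\<^sub>R b" "0 < t" "t < 1"
    using z(2) by (auto simp: in_segment)
  have "con a j = 0 \<and> con b j = 0" if "con x j = 0" for j
  proof -
    have nn: "0 \<le> con a j" "0 \<le> con b j"
      using ab by (auto simp: kostka_polytope_eq ineq_coneD)
    have "(1 - t) * con a j + t * con b j = 0"
      using z(1) that by (simp add: face_word_eq[OF x] t(1) con_linear)
    then show ?thesis
      using nn t by (simp add: add_nonneg_eq_0_iff)
  qed
  then show "a \<in> face (word x)" "b \<in> face (word x)"
    using ab by (auto simp: face_word_eq[OF x])
qed

text \<open>From any \<open>q\<close> in the face one can continue a little past \<open>x\<close>,
  since \<open>x - q\<close> vanishes on every inequality tight at \<open>x\<close>. This
  prolongation property characterises relative interior points.\<close>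

lemma in_rel_interior_face_word:
  fixes x :: "'r::{finite,linorder} kostka_space"
  assumes x: "x \<in> kostka_polytope"
  shows "x \<in> rel_interior (face (word x))"
proof -
  have x': "x \<in> face (word x)"
    using x by (simp add: face_word_eq)
  have "\<exists>e>1. (1 - e) *\<^sub>R q + e *\<^sub>R x \<in> face (word x)" if q: "q \<in> face (word x)" for q
  proof -
    obtain e where e: "e > 0" "x + e *\<^sub>R (x - q) \<in> ineq_cone"
      using ineq_cone_move[of x "x - q"] x q by (auto simp: face_word_eq kostka_polytope_eq con_linear)
    moreover have "(1 - (1 + e)) *\<^sub>R q + (1 + e) *\<^sub>R x = x + e *\<^sub>R (x - q)"
      by (simp add: algebra_simps)
    moreover have "x + e *\<^sub>R (x - q) \<in> face (word x)"
      using e(2) x q by (auto simp: face_word_eq[OF x] kostka_polytope_eq con_linear coord_total_linear)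
    ultimately show ?thesis
      by (intro exI[of _ "1 + e"]) auto
  qed
  moreover have "convex (face (word x) :: 'r kostka_space set)"
    using face_of_imp_convex[OF face_word_face_of[OF x]] convex_kostka_polytope by simp
  ultimately show ?thesis
    using convex_rel_interior_iff[of "face (word x)" x] x' by auto
qed

text \<open>A relative interior point \<open>x\<close> of \<open>F\<close> is also one of
  \<open>face (word x)\<close>, and faces whose relative interiors meet are equal.\<close>

lemma nonempty_face_eq:
  fixes F :: "'r::{finite,linorder} kostka_space set"
  assumes "F face_of kostka_polytope" "F \<noteq> {}"
  shows "\<exists>x\<in>(kostka_polytope :: 'r kostka_space set). F = face (word x)"
proof -
  have "convex F"
    using assms(1) by (simp add: face_of_imp_convex)
  then obtain x where x: "x \<in> rel_interior F"
    using assms(2) rel_interior_eq_empty by blast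
  then have "x \<in> kostka_polytope"
    using rel_interior_subset face_of_imp_subset[OF assms(1)] by blast
  moreover from this have "F = face (word x)"
    using x in_rel_interior_face_word[of x] by (intro face_of_eq[OF assms(1) face_word_face_of]) auto
  ultimately show ?thesis by blast
qed

lemma word_eq_if_face_eq:
  fixes x y :: "'r::{finite,linorder} kostka_space"
  assumes "x \<in> kostka_polytope" "y \<in> kostka_polytope"
    "(face (word x) :: 'r kostka_space set) = face (word y)"
  shows "word x = word y"
proof -
  have "x \<in> face (word y)" "y \<in> face (word x)"
    using assms face_word_eq[of x] face_word_eq[of y] by auto
  then have "con x j = 0 \<longleftrightarrow> con y j = 0" for j
    using face_word_eq[OF assms(1)] face_word_eq[OF assms(2)] by auto
  then have "da x n = 0 \<longleftrightarrow> da y n = 0" "db x n = 0 \<longleftrightarrow> db y n = 0" "ps x n = 0 \<longleftrightarrow> ps y n = 0" for n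
    by (metis con.simps)+
  then show ?thesis
    by (simp add: word_def letter_of_def)
qed

lemma aff_dim_face_word:
  fixes x :: "'r::{finite,linorder} kostka_space"
  assumes x: "x \<in> kostka_polytope"
  shows "aff_dim (face (word x) :: 'r kostka_space set) = int (word_weight (word x)) - 1"
proof -
  define H :: "'r kostka_space set" where "H = {p. (1, 1) \<bullet> p = 1}"
  have H: "p \<in> H \<longleftrightarrow> coord_total p = 1" for p
    by (simp add: H_def coord_total_def inner_prod_def inner_vec_def sum.distrib)
  have xc: "x \<in> ineq_cone" "coord_total x = 1"
    using x by (auto simp: kostka_polytope_eq)
  have x_face: "x \<in> face (word x)"
    using x by (simp add: face_word_eq)
  \<comment> \<open>A short move from \<open>x\<close> towards \<open>q\<close> stays in the face,
    and the line through \<open>x\<close> and the point reached contains \<open>q\<close>.\<close>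
  have "stratum (word x) \<inter> H \<subseteq> affine hull face (word x)"
  proof
    fix q assume q: "q \<in> stratum (word x) \<inter> H"
    then have q0: "\<forall>j. con x j = 0 \<longrightarrow> con q j = 0" "coord_total q = 1"
      using stratum_word_iff[OF xc(1)] H by auto
    obtain e where e: "e > 0" "x + e *\<^sub>R (q - x) \<in> ineq_cone"
      using ineq_cone_move[OF xc(1), of "q - x"] q0 by (auto simp: con_linear)
    have "x + e *\<^sub>R (q - x) \<in> face (word x)"
      using e(2) q0 xc by (auto simp: face_word_eq[OF x] kostka_polytope_eq con_linear coord_total_linear)
    then have "(1 - 1 / e) *\<^sub>R x + (1 / e) *\<^sub>R (x + e *\<^sub>R (q - x)) \<in> affine hull face (word x)"
      using x_face by (intro mem_affine[OF affine_affine_hull]) (auto intro: hull_inc)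
    moreover have "(1 - 1 / e) *\<^sub>R x + (1 / e) *\<^sub>R (x + e *\<^sub>R (q - x)) = q"
      using e(1) by (simp add: scaleR_add_right scaleR_diff_left)
    ultimately show "q \<in> affine hull face (word x)"
      by (simp only:)
  qed
  then have "aff_dim (stratum (word x) \<inter> H) \<le> aff_dim (face (word x) :: 'r kostka_space set)"
    using aff_dim_subset[of "stratum (word x) \<inter> H" "affine hull face (word x)"] by simp
  moreover have "aff_dim (face (word x) :: 'r kostka_space set) \<le> aff_dim (stratum (word x) \<inter> H)"
    by (rule aff_dim_subset) (auto simp: face_def H kostka_polytope_eq)
  moreover have "aff_dim (stratum (word x) \<inter> H) = int (word_weight (word x)) - 1"
  proof -
    define V :: "'r kostka_space set" where "V = stratum (word x)"
    have "x \<in> V \<inter> H"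
      using x_face xc by (simp add: face_def H V_def)
    moreover have "0 \<in> V" "0 \<notin> H"
      by (simp_all add: subspace_0[OF subspace_stratum] H_def V_def)
    moreover have "affine V"
      unfolding V_def by (rule subspace_imp_affine[OF subspace_stratum])
    \<comment> \<open>\<open>H\<close> meets \<open>V\<close> but misses the origin, so it does not
      contain \<open>V\<close> and the dimension drops by exactly one.\<close>
    ultimately have "aff_dim (V \<inter> H) = aff_dim V - 1"
      using aff_dim_affine_Int_hyperplane[of V "(1, 1)" 1] unfolding H_def by auto
    moreover have "zero_letter (word x ! (CARD('r) - 1))"
      using ineq_coneD(4)[OF xc(1)] by (simp add: zero_letter_of)
    then have "aff_dim V = int (word_weight (word x))"
      unfolding V_def aff_dim_subspace[OF subspace_stratum] by (simp add: dim_stratum)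
    ultimately show ?thesis
      by (simp add: V_def)
  qed
  ultimately show ?thesis by simp
qed

text \<open>\<open>face\<close> is a bijection from words to faces. The weight is
  \<open>Suc d\<close> because slicing costs one dimension; being positive, it ensures that each
  word has a point in the polytope.\<close>

lemma num_faces_kostka_polytope:
  "num_faces d (kostka_polytope :: 'r::{finite,linorder} kostka_space set) = card (words Outside CARD('r) (Suc d))"
proof -
  have point: "\<exists>x\<in>kostka_polytope. word (x :: 'r kostka_space) = w" if "w \<in> words Outside CARD('r) (Suc d)" for w
    using that unfolding words_def by (intro ex_polytope_point_of_word) auto
  have "inj_on (face :: _ \<Rightarrow> 'r kostka_space set) (words Outside CARD('r) (Suc d))"
  proof (rule inj_onI)
    fix w w' assume w: "w \<in> words Outside CARD('r) (Suc d)" "w' \<in> words Outside CARD('r) (Suc d)"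
      and eq: "face w = (face w' :: 'r kostka_space set)"
    obtain x y :: "'r kostka_space" where "x \<in> kostka_polytope" "word x = w" "y \<in> kostka_polytope" "word y = w'"
      using point[OF w(1)] point[OF w(2)] by blast
    with eq word_eq_if_face_eq[of x y] show "w = w'"
      by simp
  qed
  moreover have "face ` words Outside CARD('r) (Suc d)
    = {F :: 'r kostka_space set. F face_of kostka_polytope \<and> aff_dim F = int d}"
  proof (intro equalityI subsetI)
    fix F :: "'r kostka_space set" assume "F \<in> face ` words Outside CARD('r) (Suc d)"
    then obtain w where w: "w \<in> words Outside CARD('r) (Suc d)" "F = face w"
      by blast
    then obtain x :: "'r kostka_space" where x: "x \<in> kostka_polytope" "word x = w"
      using point by blast
    show "F \<in> {F. F face_of kostka_polytope \<and> aff_dim F = int d}"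
      using face_word_face_of[OF x(1)] aff_dim_face_word[OF x(1)] w x(2) by (simp add: words_def)
  next
    fix F :: "'r kostka_space set" assume F: "F \<in> {F. F face_of kostka_polytope \<and> aff_dim F = int d}"
    \<comment> \<open>The empty set has \<open>aff_dim\<close> equal to \<open>-1\<close>, while
      \<open>int d\<close> is nonnegative.\<close>
    then have "F \<noteq> {}" by auto
    with F obtain x :: "'r kostka_space" where x: "x \<in> kostka_polytope" "F = face (word x)"
      using nonempty_face_eq by blast
    then have "word_weight (word x) = Suc d"
      using aff_dim_face_word[OF x(1)] F by simp
    moreover have "accepts Outside (word x)"
      using x(1) by (intro accepts_word) (simp add: kostka_polytope_eq)
    ultimately show "F \<in> face ` words Outside CARD('r) (Suc d)"
      using x(2) by (auto simp: words_def)
  qed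
  ultimately show ?thesis
    unfolding num_faces_def by (metis card_image)
qed

theorem theorem1p2:
  fixes r :: nat
  assumes card_r: "CARD('r::{finite,linorder}) = r"
  shows "num_faces 1 (kostka_polytope :: 'r kostka_space set) =
             (r choose 6) + 2 * (r choose 5) + 6 * (r choose 4) + 7 * (r choose 3) + 3 * (r choose 2)
         \<and> num_faces 2 (kostka_polytope :: 'r kostka_space set) =
             (r choose 9) + 3 * (r choose 8) + 12 * (r choose 7) + 23 * (r choose 6)
             + 33 * (r choose 5) + 31 * (r choose 4) + 13 * (r choose 3) + (r choose 2)
         \<and> num_faces 3 (kostka_polytope :: 'r kostka_space set) =
             (r choose 12) + 4 * (r choose 11) + 19 * (r choose 10) + 49 * (r choose 9)
             + 105 * (r choose 8) + 163 * (r choose 7) + 177 * (r choose 6) + 131 * (r choose 5)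
             + 53 * (r choose 4) + 7 * (r choose 3)"
proof -
  have "num_faces 1 (kostka_polytope :: 'r kostka_space set) = card (words Outside r 2)"
    "num_faces 2 (kostka_polytope :: 'r kostka_space set) = card (words Outside r 3)"
    "num_faces 3 (kostka_polytope :: 'r kostka_space set) = card (words Outside r 4)"
    by (simp_all add: num_faces_kostka_polytope card_r eval_nat_numeral)
  then show ?thesis
    by (simp only: card_words_weight_2 card_words_weight_3 card_words_weight_4)
qed

end
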